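(* Let $A_{3\times 4}$ be the matrix defining the $3\times 4$ transportation problem. Then $u(A_{3\times 4})=g(A_{3\times 4})\geq 27$.
   Context: $A_{3\times 4}\in\mathbb{Z}^{7\times 12}$ is the matrix of the linear map sending a $3\times 4$ table $(z_{ij})$ (regarded as a vector in $\mathbb{R}^{12}$) to its $3$ row sums and $4$ column sums. Graver basis: for $A\in\mathbb{Z}^{d\times n}$, $\mathcal{G}(A):=\bigcup_{j=1}^{2^n}H_j\setminus\{0\}$, where $H_j$ is the inclusion-minimal Hilbert basis of the pointed rational cone $\{z\in\mathbb{O}_j: Az=0\}$ (i.e. the minimal generating set of the monoid of its integer points), and $\mathbb{O}_1,\dots,\mathbb{O}_{2^n}$ are the orthants of $\mathbb{R}^n$. Universal Gröbner basis: the toric ideal of $A$ is $\mathcal{I}_A:=\langle x^u-x^v : Au=Av,\ u,v\in\mathbb{Z}^n_+\rangle$ in the polynomial ring in $x_1,\dots,x_n$ over a field. For a term ordering $\prec$, the reduced Gröbner basis of $\mathcal{I}_A$ has the form $\{x^{w^+}-x^{w^-}: w\in\mathcal{G}_\prec(A)\}$ with $\mathcal{G}_\prec(A)\subseteq\ker(A)\cap\mathbb{Z}^n$, where $w=w^+-w^-$ is the decomposition into positive and negative parts. $\mathcal{U}(A)$ is the union of the sets $\mathcal{G}_\prec(A)$ over all term orderings $\prec$, where binomials are taken up to sign, so that $\mathcal{U}(A)$ is symmetric: $w\in\mathcal{U}(A)$ implies $-w\in\mathcal{U}(A)$. Higher Lawrence liftings: for a positive integer $N$, $$A^{(N)}:=\begin{pmatrix}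 I_n & I_n & \cdots & I_n\\ A & & & \\ & A & & \\ & & \ddots & \\ & & & A\end{pmatrix}$$ with $N$ blocks, $I_n$ being the $n\times n$ identity matrix. For $x=(x^1,\dots,x^N)$ with $x^i\in\mathbb{Z}^n$, the $x^i$ are the layers of $x$, and the type of $x$ is $|\{i: x^i\ne 0\}|$. Complexities: the Graver complexity $g(A)$ is the maximal type of an element of $\mathcal{G}(A^{(N)})$ over all $N$ (it is known that this is a finite constant depending only on $A$). The Gröbner complexity $u(A)$ is the maximal type of an element of $\mathcal{U}(A^{(N)})$ over all $N$. *)

theory Defs
  imports
    "HOL-Algebra.Ideal"
    "HOL-Library.Poly_Mapping"
    "HOL-Library.Extended_Nat"
    "Jordan_Normal_Form.Matrix_Kernel"
begin

section \<open>Graver bases\<close>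

text \<open>Orthants of \<open>\<real>\<^sup>n\<close> are indexed by sign vectors \<open>s\<close>; only \<open>s 0, \<dots>, s (n - 1)\<close> matter.\<close>

definition orthant :: "nat \<Rightarrow> (nat \<Rightarrow> real) \<Rightarrow> real vec set" where
  "orthant n s = {z \<in> carrier_vec n. \<forall>i<n. s i * z $ i \<ge> 0}"

definition orthants :: "nat \<Rightarrow> real vec set set" where
  "orthants n = {orthant n s | s. \<forall>i<n. s i \<in> {-1, 1}}"

definition integer_points :: "real vec set \<Rightarrow> int vec set" where
  "integer_points C = {z. map_vec real_of_int z \<in> C}"

inductive_set monoid_hull :: "nat \<Rightarrow> int vec set \<Rightarrow> int vec set" for n H where
  zero: "0\<^sub>v n \<in> monoid_hull n H"
| add: "h \<in> H \<Longrightarrow> z \<in> monoid_hull n H \<Longrightarrow> h + z \<in> monoid_hull n H"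

definition hilbert_generating :: "nat \<Rightarrow> real vec set \<Rightarrow> int vec set \<Rightarrow> bool" where
  "hilbert_generating n C H \<longleftrightarrow>
     H \<subseteq> integer_points C \<and> integer_points C \<subseteq> monoid_hull n H"

definition minimal_hilbert_basis :: "nat \<Rightarrow> real vec set \<Rightarrow> int vec set \<Rightarrow> bool" where
  "minimal_hilbert_basis n C H \<longleftrightarrow>
     hilbert_generating n C H \<and> (\<forall>H'. H' \<subset> H \<longrightarrow> \<not> hilbert_generating n C H')"

definition graver_basis :: "int mat \<Rightarrow> int vec set" where
  "graver_basis A = (let n = dim_col A in
     (\<Union>O\<^sub>j\<in>orthants n.
        \<Union>{H. minimal_hilbert_basis n (O\<^sub>j \<inter> mat_kernel (map_mat real_of_int A)) H})
     - {0\<^sub>v n})"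


section \<open>Universal Groebner bases of toric ideals\<close>

text \<open>
  The exponent vector of a monomial is a finitely supported function; the polynomial ring in
  \<open>n\<close> variables is the subring, with variables \<open>0, \<dots>, n - 1\<close>, of the ring of all polynomials in
  countably many variables.
\<close>

type_synonym mon = "nat \<Rightarrow>\<^sub>0 nat"
type_synonym 'k mpoly = "mon \<Rightarrow>\<^sub>0 'k"

definition monomials :: "nat \<Rightarrow> mon set" where
  "monomials n = {u. Poly_Mapping.keys u \<subseteq> {..<n}}"

definition mpoly_ring :: "nat \<Rightarrow> ('k::field) mpoly ring" where
  "mpoly_ring n =
     \<lparr>carrier = {p. Poly_Mapping.keys p \<subseteq> monomials n}, mult = (*), one = 1, zero = 0, add = (+)\<rparr>"

definition mpoly_ideal :: "nat \<Rightarrow> ('k::field) mpoly set \<Rightarrow> 'k mpoly set" where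
  "mpoly_ideal n S = genideal (mpoly_ring n) S"

abbreviation xpow :: "mon \<Rightarrow> ('k::field) mpoly" where
  "xpow u \<equiv> Poly_Mapping.single u 1"

definition vec_of_mon :: "nat \<Rightarrow> mon \<Rightarrow> int vec" where
  "vec_of_mon n u = vec n (\<lambda>i. int (Poly_Mapping.lookup u i))"

definition toric_ideal :: "int mat \<Rightarrow> ('k::field) mpoly set" where
  "toric_ideal A = (let n = dim_col A in
     mpoly_ideal n {xpow u - xpow v | u v. u \<in> monomials n \<and> v \<in> monomials n \<and>
       A *\<^sub>v vec_of_mon n u = A *\<^sub>v vec_of_mon n v})"

text \<open>\<open>(u, v) \<in> r\<close> reads \<open>u \<preceq> v\<close>.\<close>

definition term_order :: "nat \<Rightarrow> mon rel \<Rightarrow> bool" where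
  "term_order n r \<longleftrightarrow> linear_order_on (monomials n) r \<and>
     (\<forall>u\<in>monomials n. (0, u) \<in> r) \<and>
     (\<forall>u v. \<forall>w\<in>monomials n. (u, v) \<in> r \<longrightarrow> (u + w, v + w) \<in> r)"

definition lead_mon :: "mon rel \<Rightarrow> ('k::field) mpoly \<Rightarrow> mon" where
  "lead_mon r p = (THE u. u \<in> Poly_Mapping.keys p \<and> (\<forall>v\<in>Poly_Mapping.keys p. (v, u) \<in> r))"

definition initial_ideal :: "nat \<Rightarrow> mon rel \<Rightarrow> ('k::field) mpoly set \<Rightarrow> 'k mpoly set" where
  "initial_ideal n r F = mpoly_ideal n {xpow (lead_mon r f) | f. f \<in> F \<and> f \<noteq> 0}"

definition groebner_basis ::
    "nat \<Rightarrow> mon rel \<Rightarrow> ('k::field) mpoly set \<Rightarrow> 'k mpoly set \<Rightarrow> bool" where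
  "groebner_basis n r I G \<longleftrightarrow>
     finite G \<and> G \<subseteq> I \<and> initial_ideal n r G = initial_ideal n r I"

definition mon_dvd :: "mon \<Rightarrow> mon \<Rightarrow> bool" where
  "mon_dvd u v \<longleftrightarrow> (\<forall>i. Poly_Mapping.lookup u i \<le> Poly_Mapping.lookup v i)"

definition reduced_groebner_basis ::
    "nat \<Rightarrow> mon rel \<Rightarrow> ('k::field) mpoly set \<Rightarrow> 'k mpoly set \<Rightarrow> bool" where
  "reduced_groebner_basis n r I G \<longleftrightarrow> groebner_basis n r I G \<and>
     (\<forall>g\<in>G. g \<noteq> 0 \<and> Poly_Mapping.lookup g (lead_mon r g) = 1) \<and>
     (\<forall>g\<in>G. \<forall>h\<in>G. g \<noteq> h \<longrightarrow> (\<forall>u\<in>Poly_Mapping.keys h. \<not> mon_dvd (lead_mon r g) u))"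

lift_definition pos_mon :: "int vec \<Rightarrow> mon" is
  "\<lambda>w i. if i < dim_vec w then nat (w $ i) else 0"
  by (rule finite_subset[of _ "{..<dim_vec w}" for w]) (auto split: if_splits)

text \<open>\<open>vec_binomial w\<close> is \<open>x\<^sup>u - x\<^sup>v\<close> with \<open>u = w\<^sup>+\<close> and \<open>v = w\<^sup>- = (-w)\<^sup>+\<close>.\<close>

definition vec_binomial :: "int vec \<Rightarrow> ('k::field) mpoly" where
  "vec_binomial w = xpow (pos_mon w) - xpow (pos_mon (- w))"

text \<open>The type argument is the coefficient field.\<close>

definition universal_groebner_basis :: "('k::field) itself \<Rightarrow> int mat \<Rightarrow> int vec set" where
  "universal_groebner_basis _ A = (let n = dim_col A in
     {w \<in> carrier_vec n. \<exists>r (G :: 'k mpoly set).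
        term_order n r \<and> reduced_groebner_basis n r (toric_ideal A) G \<and>
        (vec_binomial w \<in> G \<or> vec_binomial (- w) \<in> G)})"


section \<open>Higher Lawrence liftings and complexities\<close>

definition lawrence_lifting :: "int mat \<Rightarrow> nat \<Rightarrow> int mat" where
  "lawrence_lifting A N = (let n = dim_col A in
     mat n (N * n) (\<lambda>(i, j). if j mod n = i then 1 else 0)
     @\<^sub>r diag_block_mat (replicate N A))"

definition layer :: "nat \<Rightarrow> int vec \<Rightarrow> nat \<Rightarrow> int vec" where
  "layer n x i = vec n (\<lambda>j. x $ (i * n + j))"

definition vec_type :: "nat \<Rightarrow> nat \<Rightarrow> int vec \<Rightarrow> nat" where
  "vec_type n N x = card {i. i < N \<and> layer n x i \<noteq> 0\<^sub>v n}"

text \<open>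
  The maximal types are suprema in the extended naturals, so that both complexities are
  well defined without appeal to their finiteness.
\<close>

definition graver_complexity :: "int mat \<Rightarrow> enat" where
  "graver_complexity A = (SUP N\<in>{1..}. SUP x\<in>graver_basis (lawrence_lifting A N).
     enat (vec_type (dim_col A) N x))"

definition groebner_complexity :: "('k::field) itself \<Rightarrow> int mat \<Rightarrow> enat" where
  "groebner_complexity K A =
     (SUP N\<in>{1..}. SUP x\<in>universal_groebner_basis K (lawrence_lifting A N).
        enat (vec_type (dim_col A) N x))"


section \<open>Transportation problems\<close>

text \<open>
  Tables are flattened row by row: entry \<open>(i, j)\<close> of a \<open>p \<times> q\<close> table has index \<open>i * q + j\<close>.
  The first \<open>p\<close> rows give the row sums, the last \<open>q\<close> rows the column sums.
\<close>

definition transportation_mat :: "nat \<Rightarrow> nat \<Rightarrow> int mat" where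
  "transportation_mat p q = mat (p + q) (p * q)
     (\<lambda>(k, c). if k < p then (if c div q = k then 1 else 0)
               else (if c mod q = k - p then 1 else 0))"

end

theory Submission
  imports Defs
begin

text \<open>
  An integer kernel vector is primitive if no other nonzero kernel vector lies conformally below
  it; the Graver basis is the set of primitive vectors, and it contains the universal Groebner
  basis. A primitive vector of a higher Lawrence lifting stays primitive when a layer is replaced
  by the two summands of a conformal decomposition, so the Graver complexity is attained on
  vectors whose layers are irreducible. For the transportation matrix these are cycles of the
  complete bipartite graph, and every kernel vector supported on a cycle is a multiple of it. Hence
  if all layers of a primitive \<open>x\<close> are cycles, then \<open>x\<^sup>+\<close> and \<open>x\<^sup>-\<close> are the only points of
  their fiber supported on the support of \<open>x\<close>, and a term order with weight 0 on that support and
  1 elsewhere puts \<open>x\<close> into a reduced Groebner basis. The lower bound comes from seven hexagons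
  whose unique linear relation has coefficients 6, 4, 3, 2, 4, 3, 5.
\<close>

subsection \<open>Conformal decompositions and the Graver basis\<close>

text \<open>The universal Groebner basis can be strictly smaller than the Graver basis, so equal
  complexities need a reason. Membership is not preserved by refinement, but the type never drops: a
  layer split into two nonzero conformal summands counts twice. Refinement must end in integral
  circuits; bipartite graphs provide this because their circuits have entries 0, 1, -1, so some
  circuit lies conformally below every nonzero integer table with zero margins. Groebner bases are
  treated through fibers instead of division: the least monomials of the fibers determine an
  explicit reduced basis, so the work happens on exponents and is uniform in the coefficient field.
  As for 27: the 3 x 4 tables with zero margins have rank (3-1)(4-1) = 6, so seven hexagons spanning
  them satisfy one relation up to scaling. Repeating each hexagon as often as its coefficient
  demands gives 27 layers with sum zero. Since the coefficients have greatest common divisor 1, no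
  proper nonempty subfamily of these layers has sum zero, which is primitivity.\<close>

definition conformal :: "int vec \<Rightarrow> int vec \<Rightarrow> bool" where
  "conformal v w \<longleftrightarrow> dim_vec v = dim_vec w \<and>
     (\<forall>i<dim_vec w. 0 \<le> v $ i \<and> v $ i \<le> w $ i \<or> w $ i \<le> v $ i \<and> v $ i \<le> 0)"

definition primitive :: "int mat \<Rightarrow> int vec \<Rightarrow> bool" where
  "primitive A w \<longleftrightarrow> w \<in> mat_kernel A \<and> w \<noteq> 0\<^sub>v (dim_col A) \<and>
     (\<forall>v\<in>mat_kernel A. conformal v w \<longrightarrow> v = 0\<^sub>v (dim_col A) \<or> v = w)"

definition norm1 :: "int vec \<Rightarrow> nat" where
  "norm1 v = (\<Sum>i<dim_vec v. nat \<bar>v $ i\<bar>)"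

lemma mat_kernel_dim: "v \<in> mat_kernel A \<Longrightarrow> dim_vec v = dim_col A"
  by (simp add: mat_kernel_def)

lemma zero_in_mat_kernel: "0\<^sub>v (dim_col A) \<in> mat_kernel (A :: int mat)"
  by (auto simp: mat_kernel_def intro!: eq_vecI)

lemma mat_kernel_add:
  assumes "v \<in> mat_kernel A" "w \<in> mat_kernel A"
  shows "v + w \<in> mat_kernel (A :: int mat)"
proof -
  have "A *\<^sub>v (v + w) = A *\<^sub>v v + A *\<^sub>v w"
    using assms by (intro mult_add_distrib_mat_vec[of _ "dim_row A" "dim_col A"])
      (auto simp: mat_kernel_def)
  then show ?thesis using assms by (auto simp: mat_kernel_def)
qed

lemma mat_kernel_minus:
  assumes "v \<in> mat_kernel A" "w \<in> mat_kernel A"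
  shows "v - w \<in> mat_kernel (A :: int mat)"
proof -
  have "A *\<^sub>v (v - w) = A *\<^sub>v v - A *\<^sub>v w"
    using assms by (intro mult_minus_distrib_mat_vec[of _ "dim_row A" "dim_col A"])
      (auto simp: mat_kernel_def)
  then show ?thesis using assms by (auto simp: mat_kernel_def)
qed

lemma mat_kernel_uminus:
  assumes "v \<in> mat_kernel A"
  shows "- v \<in> mat_kernel (A :: int mat)"
  using mat_kernel_minus[OF zero_in_mat_kernel assms] assms by (simp add: mat_kernel_def)

lemma norm1_eq_0: "v \<in> carrier_vec n \<Longrightarrow> norm1 v = 0 \<longleftrightarrow> v = 0\<^sub>v n"
  by (auto simp: norm1_def intro!: eq_vecI)

lemma conformal_refl: "conformal v v"
  unfolding conformal_def by auto

lemma conformal_diff: "conformal v w \<Longrightarrow> conformal (w - v) w"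
  unfolding conformal_def by auto

text \<open>Conformal summands never cancel, so absolute values add up coordinatewise. This makes
  the 1-norm the measure for descents along conformal decompositions.\<close>

lemma norm1_conformal_add:
  assumes "conformal v w"
  shows "norm1 w = norm1 v + norm1 (w - v)"
proof -
  have *: "nat \<bar>w $ i\<bar> = nat \<bar>v $ i\<bar> + nat \<bar>(w - v) $ i\<bar>" if "i < dim_vec w" for i
    using assms that by (force simp: conformal_def)
  have "norm1 w = (\<Sum>i<dim_vec w. nat \<bar>v $ i\<bar> + nat \<bar>(w - v) $ i\<bar>)"
    unfolding norm1_def using * by (intro sum.cong) auto
  then show ?thesis using assms by (simp add: norm1_def sum.distrib conformal_def)
qed

lemma conformal_uminus: "conformal (- v) (- w) \<longleftrightarrow> conformal v w"
  by (auto simp: conformal_def)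

lemma primitive_uminus:
  assumes "primitive A w"
  shows "primitive A (- w)"
  unfolding primitive_def
proof (intro conjI ballI impI)
  have wk: "w \<in> mat_kernel A" and w0: "w \<noteq> 0\<^sub>v (dim_col A)"
    and wp: "\<And>v. v \<in> mat_kernel A \<Longrightarrow> conformal v w \<Longrightarrow> v = 0\<^sub>v (dim_col A) \<or> v = w"
    using assms by (auto simp: primitive_def)
  show "- w \<in> mat_kernel A" using wk by (rule mat_kernel_uminus)
  show "- w \<noteq> 0\<^sub>v (dim_col A)" using w0 wk by (metis uminus_uminus_vec uminus_zero_vec)
  fix v assume v: "v \<in> mat_kernel A" "conformal v (- w)"
  then have "conformal (- v) w" using conformal_uminus[of "- v" w] by simp
  then have "- v = 0\<^sub>v (dim_col A) \<or> - v = w" using wp mat_kernel_uminus[OF v(1)] by blast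
  then show "v = 0\<^sub>v (dim_col A) \<or> v = - w" by (metis uminus_uminus_vec uminus_zero_vec)
qed

section \<open>Integer points of the orthant cones and their generating sets\<close>

definition orthant_kernel :: "int mat \<Rightarrow> (nat \<Rightarrow> real) \<Rightarrow> int vec set" where
  "orthant_kernel A s =
     {z \<in> mat_kernel A. \<forall>i<dim_col A. 0 \<le> s i * real_of_int (z $ i)}"

lemma orthant_kernel_dim: "v \<in> orthant_kernel A s \<Longrightarrow> dim_vec v = dim_col A"
  by (simp add: orthant_kernel_def mat_kernel_def)

lemma integer_points_orthant:
  "integer_points (orthant (dim_col A) s \<inter> mat_kernel (map_mat real_of_int A)) = orthant_kernel A s"
proof -
  have "map_mat real_of_int A *\<^sub>v map_vec real_of_int z = 0\<^sub>v (dim_row A)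
      \<longleftrightarrow> A *\<^sub>v z = 0\<^sub>v (dim_row A)" if "dim_vec z = dim_col A" for z
  proof -
    have "map_mat real_of_int A *\<^sub>v map_vec real_of_int z = map_vec real_of_int (A *\<^sub>v z)"
      using that by (intro of_int_hom.mult_mat_vec_hom[symmetric]) (auto intro: carrier_vecI)
    then show ?thesis by (auto simp: vec_eq_iff)
  qed
  note eq = this
  have "map_vec real_of_int z \<in> orthant (dim_col A) s \<inter> mat_kernel (map_mat real_of_int A)
      \<longleftrightarrow> z \<in> orthant_kernel A s" for z
  proof (cases "dim_vec z = dim_col A")
    case True
    then have z: "z \<in> carrier_vec (dim_col A)" by (auto intro: carrier_vecI)
    show ?thesis
      using True z eq[OF True] unfolding orthant_kernel_def orthant_def mat_kernel_def by auto
  next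
    case False
    then have "z \<notin> carrier_vec (dim_col A)" by auto
    then show ?thesis unfolding orthant_kernel_def orthant_def mat_kernel_def by auto
  qed
  then show ?thesis by (simp add: integer_points_def)
qed

text \<open>Addition inside one orthant cannot cancel. Together with the next lemma this identifies
  decompositions in the monoid of a cone with conformal decompositions.\<close>

lemma orthant_kernel_conformal:
  assumes s: "\<forall>i<dim_col A. s i \<in> {-1, 1}"
    and v: "v \<in> orthant_kernel A s" and w: "w \<in> orthant_kernel A s"
  shows "conformal v (v + w)"
  unfolding conformal_def
proof (intro conjI allI impI)
  show "dim_vec v = dim_vec (v + w)"
    using orthant_kernel_dim[OF v] orthant_kernel_dim[OF w] by simp
  fix i assume "i < dim_vec (v + w)"
  then have i: "i < dim_col A" "i < dim_vec w" using orthant_kernel_dim[OF w] by simp_all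
  then have "s i = -1 \<or> s i = 1" using s by auto
  then show "0 \<le> v $ i \<and> v $ i \<le> (v + w) $ i \<or> (v + w) $ i \<le> v $ i \<and> v $ i \<le> 0"
    using v w i by (auto simp: orthant_kernel_def mat_kernel_dim)
qed

text \<open>Where \<open>w\<close> vanishes so does \<open>v\<close>; hence \<open>v\<close> lies in
  every closed orthant containing \<open>w\<close>, even if \<open>w\<close> is on the boundary of
  several.\<close>

lemma conformal_orthant_kernel:
  assumes w: "w \<in> orthant_kernel A s" and v: "v \<in> mat_kernel A" and c: "conformal v w"
  shows "v \<in> orthant_kernel A s"
proof -
  have "0 \<le> s i * real_of_int (v $ i)" if i: "i < dim_col A" for i
  proof -
    have "0 \<le> s i * real_of_int (w $ i)" "dim_vec w = dim_col A"
      using w i by (auto simp: orthant_kernel_def mat_kernel_dim)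
    then show ?thesis using c i
      unfolding conformal_def zero_le_mult_iff by (smt (verit, best) of_int_0_le_iff of_int_le_0_iff of_int_0_eq_iff)
  qed
  then show ?thesis using v by (simp add: orthant_kernel_def)
qed

lemma monoid_hull_dim:
  assumes "H \<subseteq> carrier_vec n" "z \<in> monoid_hull n H"
  shows "z \<in> carrier_vec n"
  using assms(2) by induction (use assms(1) in auto)

lemma monoid_hull_add:
  assumes H: "H \<subseteq> carrier_vec n" and "y \<in> monoid_hull n H" "z \<in> monoid_hull n H"
  shows "y + z \<in> monoid_hull n H"
  using assms(2)
proof induction
  case zero
  then show ?case using assms(3) monoid_hull_dim[OF H] by simp
next
  case (add h x)
  have "h + x + z = h + (x + z)"
    using add(1,2) assms(3) monoid_hull_dim[OF H] H by (intro assoc_add_vec) auto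
  then show ?case using add by (simp add: monoid_hull.add)
qed

lemma monoid_hull_mono_hull:
  assumes "H' \<subseteq> carrier_vec n" "H \<subseteq> monoid_hull n H'"
  shows "monoid_hull n H \<subseteq> monoid_hull n H'"
proof
  fix z assume "z \<in> monoid_hull n H"
  then show "z \<in> monoid_hull n H'"
    by induction (use assms monoid_hull_add[OF assms(1)] in \<open>auto intro: monoid_hull.zero\<close>)
qed

lemma monoid_hull_self: "H \<subseteq> carrier_vec n \<Longrightarrow> h \<in> H \<Longrightarrow> h \<in> monoid_hull n H"
  using monoid_hull.add[of h H "0\<^sub>v n" n] monoid_hull.zero[of n H] by auto

lemma orthant_kernel_add:
  assumes "v \<in> orthant_kernel A s" "w \<in> orthant_kernel A s"
  shows "v + w \<in> orthant_kernel A s"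
  using assms mat_kernel_add by (auto simp: orthant_kernel_def distrib_left mat_kernel_dim)

lemma monoid_hull_orthant_kernel:
  assumes H: "H \<subseteq> orthant_kernel A s"
  shows "monoid_hull (dim_col A) H \<subseteq> orthant_kernel A s"
proof
  fix z assume "z \<in> monoid_hull (dim_col A) H"
  then show "z \<in> orthant_kernel A s"
    by induction (use H orthant_kernel_add in \<open>auto simp: orthant_kernel_def zero_in_mat_kernel\<close>)
qed

lemma orthant_kernel_carrier: "orthant_kernel A s \<subseteq> carrier_vec (dim_col A)"
  by (auto simp: orthant_kernel_def mat_kernel_def)

lemma not_primitive_split:
  assumes "z \<in> mat_kernel A" "z \<noteq> 0\<^sub>v (dim_col A)" "\<not> primitive A z"
  obtains v where "v \<in> mat_kernel A" "conformal v z" "norm1 v < norm1 z" "norm1 (z - v) < norm1 z"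
    "v \<noteq> 0\<^sub>v (dim_col A)" "v \<noteq> z"
proof -
  obtain v where v: "v \<in> mat_kernel A" "conformal v z" "v \<noteq> 0\<^sub>v (dim_col A)" "v \<noteq> z"
    using assms by (auto simp: primitive_def)
  have c: "v \<in> carrier_vec (dim_col A)" "z \<in> carrier_vec (dim_col A)" "z - v \<in> carrier_vec (dim_col A)"
    using v(1) assms(1) by (auto simp: mat_kernel_def)
  have "z - v \<noteq> 0\<^sub>v (dim_col A)"
    using v(4) c(1,2) by (auto simp: vec_eq_iff)
  then have "norm1 v \<noteq> 0" "norm1 (z - v) \<noteq> 0" using v(3) c norm1_eq_0 by blast+
  then show thesis using that[OF v(1,2)] v(3,4) norm1_conformal_add[OF v(2)] by simp
qed

lemma diff_add_vec: "v \<in> carrier_vec n \<Longrightarrow> w \<in> carrier_vec n \<Longrightarrow> v + (w - v) = (w :: int vec)"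
  by (auto simp: vec_eq_iff)

text \<open>Descent on the 1-norm: a vector that is not primitive splits into two shorter kernel
  vectors of the same orthant.\<close>

lemma primitives_generate:
  assumes "z \<in> orthant_kernel A s"
  shows "z \<in> monoid_hull (dim_col A) {w \<in> orthant_kernel A s. primitive A w}"
    (is "_ \<in> monoid_hull _ ?H")
  using assms
proof (induction "norm1 z" arbitrary: z rule: less_induct)
  case less
  have H: "?H \<subseteq> carrier_vec (dim_col A)" using orthant_kernel_carrier by blast
  have zk: "z \<in> mat_kernel A" using less.prems by (simp add: orthant_kernel_def)
  consider "z = 0\<^sub>v (dim_col A)" | "primitive A z" | "z \<noteq> 0\<^sub>v (dim_col A)" "\<not> primitive A z" by blast
  then show ?case
  proof cases
    case 1
    then show ?thesis using monoid_hull.zero by blast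
  next
    case 2
    then show ?thesis using less.prems monoid_hull_self[OF H] by blast
  next
    case 3
    obtain v where v: "v \<in> mat_kernel A" "conformal v z" "norm1 v < norm1 z" "norm1 (z - v) < norm1 z"
      using not_primitive_split[OF zk 3] by metis
    have "v \<in> orthant_kernel A s" using conformal_orthant_kernel[OF less.prems v(1,2)] .
    moreover have "z - v \<in> orthant_kernel A s"
      using conformal_orthant_kernel[OF less.prems mat_kernel_minus[OF zk v(1)] conformal_diff[OF v(2)]] .
    ultimately have "v + (z - v) \<in> monoid_hull (dim_col A) ?H"
      using less.hyps v(3,4) monoid_hull_add[OF H] by blast
    moreover have "v + (z - v) = z" using v(1) zk by (intro diff_add_vec) (auto simp: mat_kernel_def)
    ultimately show ?thesis by simp
  qed
qed

text \<open>In a sum \<open>h + z\<close> equal to a primitive vector the summand \<open>h\<close>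
  is zero or everything, so some generator must be the vector itself.\<close>

lemma primitive_in_generators:
  assumes s: "\<forall>i<dim_col A. s i \<in> {-1, 1}" and H: "H \<subseteq> orthant_kernel A s"
    and "w \<in> monoid_hull (dim_col A) H" "primitive A w"
  shows "w \<in> H"
  using assms(3,4)
proof induction
  case zero
  then show ?case by (simp add: primitive_def)
next
  case (add h z)
  have h: "h \<in> orthant_kernel A s" and z: "z \<in> orthant_kernel A s"
    using add H monoid_hull_orthant_kernel[OF H] by auto
  have "h \<in> mat_kernel A" using h by (simp add: orthant_kernel_def)
  then have "h = 0\<^sub>v (dim_col A) \<or> h = h + z"
    using add.prems orthant_kernel_conformal[OF s h z] by (auto simp: primitive_def)
  moreover have "h = 0\<^sub>v (dim_col A) \<Longrightarrow> h + z = z"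
    using z subsetD[OF orthant_kernel_carrier] by auto
  ultimately show ?case using add by metis
qed

text \<open>If \<open>w\<close> were not primitive, it would be a sum of two shorter vectors. Their
  representations cannot involve \<open>w\<close>, so \<open>w\<close> could be removed from
  \<open>H\<close>, against minimality.\<close>

lemma minimal_hilbert_basis_primitive:
  assumes s: "\<forall>i<dim_col A. s i \<in> {-1, 1}" and H: "H \<subseteq> orthant_kernel A s"
    and gen: "orthant_kernel A s \<subseteq> monoid_hull (dim_col A) H"
    and min: "\<And>H'. H' \<subset> H \<Longrightarrow> \<not> orthant_kernel A s \<subseteq> monoid_hull (dim_col A) H'"
    and w: "w \<in> H" "w \<noteq> 0\<^sub>v (dim_col A)"
  shows "primitive A w"
proof (rule ccontr)
  assume np: "\<not> primitive A w"
  let ?n = "dim_col A" and ?H = "H - {w}"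
  have wo: "w \<in> orthant_kernel A s" and wk: "w \<in> mat_kernel A"
    using w H by (auto simp: orthant_kernel_def)
  have car: "H \<subseteq> carrier_vec ?n" "?H \<subseteq> carrier_vec ?n" using H orthant_kernel_carrier by blast+
  \<comment> \<open>A sum within the orthant is at least as long as each of its summands, so a
    vector shorter than \<open>w\<close> is generated without \<open>w\<close>.\<close>
  have small: "z \<in> monoid_hull ?n ?H" if "z \<in> monoid_hull ?n H" "norm1 z < norm1 w" for z
    using that
  proof induction
    case zero
    then show ?case by (intro monoid_hull.zero)
  next
    case (add h z)
    have h: "h \<in> orthant_kernel A s" and z: "z \<in> orthant_kernel A s"
      using add H monoid_hull_orthant_kernel[OF H] by auto
    have "h + z - h = z"
      using orthant_kernel_dim[OF h] orthant_kernel_dim[OF z] by (auto simp: vec_eq_iff)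
    then have "norm1 (h + z) = norm1 h + norm1 z"
      using norm1_conformal_add[OF orthant_kernel_conformal[OF s h z]] by simp
    then show ?case using add by (intro monoid_hull.add) auto
  qed
  obtain v where v: "v \<in> mat_kernel A" "conformal v w" "norm1 v < norm1 w" "norm1 (w - v) < norm1 w"
    using not_primitive_split[OF wk w(2) np] by metis
  have "v \<in> orthant_kernel A s" using conformal_orthant_kernel[OF wo v(1,2)] .
  moreover have "w - v \<in> orthant_kernel A s"
    using conformal_orthant_kernel[OF wo mat_kernel_minus[OF wk v(1)] conformal_diff[OF v(2)]] .
  ultimately have "v + (w - v) \<in> monoid_hull ?n ?H"
    using gen small v(3,4) monoid_hull_add[OF car(2)] by blast
  moreover have "v + (w - v) = w" using v(1) wk by (intro diff_add_vec) (auto simp: mat_kernel_def)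
  ultimately have "w \<in> monoid_hull ?n ?H" by simp
  then have "H \<subseteq> monoid_hull ?n ?H" using monoid_hull_self[OF car(2)] by blast
  then have "orthant_kernel A s \<subseteq> monoid_hull ?n ?H"
    using gen monoid_hull_mono_hull[OF car(2)] by blast
  then show False using min[of ?H] w(1) by blast
qed

text \<open>For a primitive vector, the primitive vectors of an orthant containing it form a minimal
  Hilbert basis there: they generate, and every generating set must contain them all.\<close>

theorem graver_basis_eq_primitive: "graver_basis A = {w. primitive A w}"
proof (intro equalityI subsetI; (elim CollectE)?)
  fix w assume "w \<in> graver_basis A"
  then obtain s H where s: "\<forall>i<dim_col A. s i \<in> {-1, 1::real}" and
    H: "minimal_hilbert_basis (dim_col A)
          (orthant (dim_col A) s \<inter> mat_kernel (map_mat real_of_int A)) H" and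
    w: "w \<in> H" "w \<noteq> 0\<^sub>v (dim_col A)"
    by (auto simp: graver_basis_def Let_def orthants_def)
  show "w \<in> {w. primitive A w}"
    using minimal_hilbert_basis_primitive[OF s, of H w] H w
    unfolding minimal_hilbert_basis_def hilbert_generating_def integer_points_orthant by blast
next
  fix w assume w: "primitive A w"
  \<comment> \<open>Any closed orthant containing \<open>w\<close> would do; zero entries are given
    the sign 1.\<close>
  define s where "s i = (if w $ i \<ge> 0 then 1 else - 1 :: real)" for i
  let ?C = "orthant (dim_col A) s \<inter> mat_kernel (map_mat real_of_int A)"
  let ?H = "{w \<in> orthant_kernel A s. primitive A w}"
  have s: "\<forall>i<dim_col A. s i \<in> {-1, 1}" by (auto simp: s_def)
  have "\<not> orthant_kernel A s \<subseteq> monoid_hull (dim_col A) H'" if "H' \<subset> ?H" for H'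
    using that primitive_in_generators[OF s, of H'] by blast
  then have "minimal_hilbert_basis (dim_col A) ?C ?H"
    unfolding minimal_hilbert_basis_def hilbert_generating_def integer_points_orthant
    using primitives_generate[of _ A s] by blast
  moreover have "w \<in> ?H" using w by (auto simp: orthant_kernel_def s_def primitive_def)
  moreover have "orthant (dim_col A) s \<in> orthants (dim_col A)"
    using s by (auto simp: orthants_def)
  ultimately show "w \<in> graver_basis A"
    using w unfolding graver_basis_def Let_def primitive_def by blast
qed

subsection \<open>Dickson's lemma and monomial ideals\<close>

text \<open>A monotone subsequence always exists. If it is not increasing it is a decreasing
  sequence of naturals, constant from the index of its least value on, and that tail is
  increasing.\<close>

lemma nat_seq_incseq_subseq:
  fixes g :: "nat \<Rightarrow> nat"
  obtains f where "strict_mono f" "incseq (g \<circ> f)"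
proof -
  obtain f :: "nat \<Rightarrow> nat" where f: "strict_mono f" "monoseq (\<lambda>n. g (f n))"
    using seq_monosub[of g] by blast
  show thesis
  proof (cases "incseq (\<lambda>n. g (f n))")
    case True
    then show thesis using that[OF f(1)] by (simp add: comp_def)
  next
    case False
    then have dec: "decseq (\<lambda>n. g (f n))"
      using f(2) by (simp add: monoseq_iff)
    obtain k where k: "\<And>m. g (f k) \<le> g (f m)"
      using ex_has_least_nat[of "\<lambda>_. True" 0 "\<lambda>n. g (f n)"] by blast
    have const: "g (f (n + k)) = g (f k)" for n
      using decseqD[OF dec, of k "n + k"] k[of "n + k"] by simp
    have "strict_mono (\<lambda>n. f (n + k))"
      using f(1) by (simp add: strict_mono_def)
    moreover have "incseq (g \<circ> (\<lambda>n. f (n + k)))"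
      by (simp add: incseq_def comp_def const)
    ultimately show thesis using that by blast
  qed
qed

text \<open>Thinning out coordinate by coordinate is harmless, since a subsequence of an increasing
  sequence is increasing.\<close>

lemma dickson_subseq:
  fixes u :: "nat \<Rightarrow> nat \<Rightarrow> nat"
  shows "\<exists>f. strict_mono f \<and> (\<forall>i<n. incseq (\<lambda>k. u (f k) i))"
proof (induction n)
  case 0
  show ?case by (rule exI[of _ id]) (simp add: strict_mono_def)
next
  case (Suc n)
  then obtain f where f: "strict_mono f" "\<forall>i<n. incseq (\<lambda>k. u (f k) i)" by blast
  obtain g where g: "strict_mono g" "incseq ((\<lambda>k. u (f k) n) \<circ> g)"
    using nat_seq_incseq_subseq .
  have "incseq (\<lambda>k. u (f (g k)) i)" if "i < Suc n" for i
  proof (cases "i = n")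
    case True
    then show ?thesis using g(2) by (simp add: comp_def)
  next
    case False
    then have "incseq (\<lambda>k. u (f k) i)" using f(2) that by simp
    then show ?thesis using g(1) by (meson incseq_def strict_mono_mono monoD)
  qed
  moreover have "strict_mono (f \<circ> g)" using f(1) g(1) by (rule strict_mono_o)
  ultimately show ?case by (intro exI[of _ "f \<circ> g"]) (auto simp: comp_def)
qed

lemma mon_dvd_refl [simp]: "mon_dvd u u"
  by (simp add: mon_dvd_def)

lemma mon_dvd_trans: "mon_dvd u v \<Longrightarrow> mon_dvd v w \<Longrightarrow> mon_dvd u w"
  unfolding mon_dvd_def by (meson order.trans)

lemma mon_dvd_antisym: "mon_dvd u v \<Longrightarrow> mon_dvd v u \<Longrightarrow> u = v"
  unfolding mon_dvd_def by (meson antisym poly_mapping_eqI)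

lemma mon_dvd_add [simp]: "mon_dvd u (u + v)"
  by (simp add: mon_dvd_def lookup_add)

lemma mon_dvd_add_diff: "mon_dvd u v \<Longrightarrow> u + (v - u) = v"
  by (rule poly_mapping_eqI) (simp add: mon_dvd_def lookup_add lookup_minus)

lemma monomials_add: "u \<in> monomials n \<Longrightarrow> v \<in> monomials n \<Longrightarrow> u + v \<in> monomials n"
  unfolding monomials_def using keys_add[of u v] by blast

lemma monomials_zero [simp]: "0 \<in> monomials n"
  by (simp add: monomials_def)

lemma monomials_iff: "u \<in> monomials n \<longleftrightarrow> (\<forall>i\<ge>n. Poly_Mapping.lookup u i = 0)"
  unfolding monomials_def by (force simp: in_keys_iff subset_eq not_less[symmetric])

lemma monomials_dvd: "mon_dvd u v \<Longrightarrow> v \<in> monomials n \<Longrightarrow> u \<in> monomials n"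
  by (simp add: monomials_iff mon_dvd_def) (metis le_zero_eq)

lemma monomials_diff: "v \<in> monomials n \<Longrightarrow> v - u \<in> monomials n"
  by (rule monomials_dvd[of _ v]) (simp_all add: mon_dvd_def lookup_minus)

lemma monomials_lookup: "u \<in> monomials n \<Longrightarrow> n \<le> i \<Longrightarrow> Poly_Mapping.lookup u i = 0"
  by (simp add: monomials_iff)

definition minimal_mons :: "mon set \<Rightarrow> mon set" where
  "minimal_mons S = {u \<in> S. \<forall>v\<in>S. mon_dvd v u \<longrightarrow> v = u}"

text \<open>Infinitely many minimal monomials would form an infinite antichain for divisibility, but
  a subsequence increasing in all \<open>n\<close> exponents contains comparable members.\<close>

lemma finite_minimal_mons:
  assumes S: "S \<subseteq> monomials n"
  shows "finite (minimal_mons S)"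
proof (rule ccontr)
  assume "infinite (minimal_mons S)"
  then obtain u :: "nat \<Rightarrow> mon" where u: "inj u" "range u \<subseteq> minimal_mons S"
    using infinite_countable_subset by blast
  obtain f where f: "strict_mono f" "\<forall>i<n. incseq (\<lambda>k. Poly_Mapping.lookup (u (f k)) i)"
    using dickson_subseq[of n "\<lambda>k. Poly_Mapping.lookup (u k)"] by blast
  have mem: "u k \<in> S" for k using u(2) by (auto simp: minimal_mons_def)
  then have mon: "u k \<in> monomials n" for k using S by blast
  have "Poly_Mapping.lookup (u (f 0)) i \<le> Poly_Mapping.lookup (u (f 1)) i" for i
  proof (cases "i < n")
    case True
    then show ?thesis using f(2) by (intro incseqD[of "\<lambda>k. Poly_Mapping.lookup (u (f k)) i"]) auto
  next
    case False
    then show ?thesis using monomials_lookup[OF mon] by simp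
  qed
  then have "u (f 0) = u (f 1)"
    using u(2) mem by (auto simp: minimal_mons_def mon_dvd_def)
  then show False using u(1) f(1) by (metis injD strict_mono_eq zero_neq_one)
qed

text \<open>Among the divisors of \<open>u\<close> in \<open>S\<close>, one of least total degree is
  minimal: a divisor of it with the same degree has the same exponents.\<close>

lemma minimal_mons_below:
  assumes S: "S \<subseteq> monomials n" and u: "u \<in> S"
  obtains v where "v \<in> minimal_mons S" "mon_dvd v u"
proof -
  define deg where "deg v = (\<Sum>i<n. Poly_Mapping.lookup v i)" for v :: mon
  obtain v where v: "v \<in> S" "mon_dvd v u" and
    min: "\<And>v'. v' \<in> S \<Longrightarrow> mon_dvd v' u \<Longrightarrow> deg v \<le> deg v'"
    using ex_has_least_nat[of "\<lambda>v. v \<in> S \<and> mon_dvd v u" u deg] u by auto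
  have "w = v" if w: "w \<in> S" "mon_dvd w v" for w
  proof -
    have le: "Poly_Mapping.lookup w i \<le> Poly_Mapping.lookup v i" for i using w(2) by (simp add: mon_dvd_def)
    then have "deg w \<le> deg v" by (simp add: deg_def sum_mono)
    moreover have "deg v \<le> deg w" using min w v(2) mon_dvd_trans by blast
    ultimately have "deg w = deg v" by simp
    then have "Poly_Mapping.lookup w i = Poly_Mapping.lookup v i" if "i < n" for i
      using sum_mono_inv[of "Poly_Mapping.lookup w" "{..<n}" "Poly_Mapping.lookup v" i] le that by (simp add: deg_def)
    then have "Poly_Mapping.lookup w i = Poly_Mapping.lookup v i" for i
      using monomials_lookup[of w n i] monomials_lookup[of v n i] S w(1) v(1)
      by (cases "i < n") (simp_all add: subset_eq)
    then show ?thesis by (intro poly_mapping_eqI)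
  qed
  then show thesis using that[of v] v by (auto simp: minimal_mons_def)
qed

section \<open>The polynomial ring in \<open>n\<close> variables and its monomial ideals\<close>

lemma mpoly_ring_simps [simp]:
  "carrier (mpoly_ring n :: 'k::field mpoly ring) = {p. Poly_Mapping.keys p \<subseteq> monomials n}"
  "a \<otimes>\<^bsub>mpoly_ring n\<^esub> b = a * b" "\<one>\<^bsub>mpoly_ring n\<^esub> = (1 :: 'k mpoly)"
  "\<zero>\<^bsub>mpoly_ring n\<^esub> = (0 :: 'k mpoly)" "a \<oplus>\<^bsub>mpoly_ring n\<^esub> b = a + b"
  by (simp_all add: mpoly_ring_def)

lemma mpoly_carrier_mult:
  assumes "Poly_Mapping.keys p \<subseteq> monomials n" "Poly_Mapping.keys q \<subseteq> monomials n"
  shows "Poly_Mapping.keys (p * q) \<subseteq> monomials n"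
  using assms keys_mult[of p q] monomials_add by fast

lemma mpoly_carrier_add:
  assumes "Poly_Mapping.keys p \<subseteq> monomials n" "Poly_Mapping.keys q \<subseteq> monomials n"
  shows "Poly_Mapping.keys (p + q) \<subseteq> monomials n"
  using assms keys_add[of p q] by fast

lemma mpoly_ring_ring: "ring (mpoly_ring n :: 'k::field mpoly ring)"
proof (intro ringI abelian_groupI monoidI; simp add: mpoly_carrier_add mpoly_carrier_mult algebra_simps)
  fix p :: "'k mpoly" assume "Poly_Mapping.keys p \<subseteq> monomials n"
  then show "\<exists>q. Poly_Mapping.keys q \<subseteq> monomials n \<and> p + q = 0"
    by (intro exI[of _ "- p"]) (simp add: in_keys_iff subset_eq)
qed

interpretation mpoly: ring "mpoly_ring n :: 'k::field mpoly ring"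
  by (rule mpoly_ring_ring)

lemma mpoly_ring_minus:
  fixes p :: "'k::field mpoly"
  assumes "Poly_Mapping.keys p \<subseteq> monomials n"
  shows "\<ominus>\<^bsub>mpoly_ring n\<^esub> p = - p"
  using assms
  by (intro mpoly.minus_equality) (auto simp: in_keys_iff subset_eq)

lemma mpoly_idealI:
  fixes I :: "'k::field mpoly set"
  assumes "\<And>p. p \<in> I \<Longrightarrow> Poly_Mapping.keys p \<subseteq> monomials n" "0 \<in> I"
    and "\<And>p q. p \<in> I \<Longrightarrow> q \<in> I \<Longrightarrow> p + q \<in> I"
    and mult: "\<And>p q. p \<in> I \<Longrightarrow> Poly_Mapping.keys q \<subseteq> monomials n \<Longrightarrow> q * p \<in> I"
  shows "ideal I (mpoly_ring n)"
proof (rule idealI[OF mpoly_ring_ring])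
  have neg: "- p \<in> I" if "p \<in> I" for p
    using mult[OF that, of "- 1"] by simp
  show "subgroup I (add_monoid (mpoly_ring n))"
  proof (rule mpoly.add.subgroupI)
    show "\<ominus>\<^bsub>mpoly_ring n\<^esub> p \<in> I" if "p \<in> I" for p
      using neg that assms(1) by (simp add: mpoly_ring_minus)
  qed (use assms in \<open>auto\<close>)
qed (use mult in \<open>auto simp: mult.commute\<close>)

lemma mpoly_ideal_self:
  "S \<subseteq> {p. Poly_Mapping.keys p \<subseteq> monomials n} \<Longrightarrow> S \<subseteq> mpoly_ideal n (S :: 'k::field mpoly set)"
  unfolding mpoly_ideal_def using mpoly.genideal_self[of S n] by simp

lemma mpoly_ideal_minimal:
  "ideal I (mpoly_ring n) \<Longrightarrow> S \<subseteq> I \<Longrightarrow> mpoly_ideal n S \<subseteq> (I :: 'k::field mpoly set)"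
  unfolding mpoly_ideal_def by (rule mpoly.genideal_minimal)

lemma mpoly_ideal_ideal:
  "S \<subseteq> {p. Poly_Mapping.keys p \<subseteq> monomials n} \<Longrightarrow>
     ideal (mpoly_ideal n (S :: 'k::field mpoly set)) (mpoly_ring n)"
  unfolding mpoly_ideal_def by (rule mpoly.genideal_ideal) simp

text \<open>The polynomials all of whose terms are divisible by members of \<open>V\<close> form an
  ideal containing the generators, hence containing the ideal they generate.\<close>

lemma monomial_ideal_dvd:
  assumes V: "V \<subseteq> monomials n" and p: "p \<in> mpoly_ideal n (xpow ` V :: 'k::field mpoly set)"
    and u: "u \<in> Poly_Mapping.keys p"
  obtains v where "v \<in> V" "mon_dvd v u"
proof -
  let ?J = "{p :: 'k mpoly. Poly_Mapping.keys p \<subseteq> monomials n \<and>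
    (\<forall>u\<in>Poly_Mapping.keys p. \<exists>v\<in>V. mon_dvd v u)}"
  have "ideal ?J (mpoly_ring n)"
  proof (rule mpoly_idealI; (elim CollectE conjE)?)
    fix p q :: "'k mpoly"
    assume p: "Poly_Mapping.keys p \<subseteq> monomials n"
      "\<forall>u\<in>Poly_Mapping.keys p. \<exists>v\<in>V. mon_dvd v u"
    show "Poly_Mapping.keys p \<subseteq> monomials n" by fact
    show "q * p \<in> ?J" if q: "Poly_Mapping.keys q \<subseteq> monomials n"
    proof (intro CollectI conjI ballI mpoly_carrier_mult p q)
      fix u assume "u \<in> Poly_Mapping.keys (q * p)"
      then obtain a b where "u = b + a" "b \<in> Poly_Mapping.keys p"
        using keys_mult[of q p] by (auto simp: add.commute)
      then show "\<exists>v\<in>V. mon_dvd v u" using p(2) mon_dvd_trans mon_dvd_add by metis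
    qed
    show "p + q \<in> ?J" if q: "Poly_Mapping.keys q \<subseteq> monomials n"
      "\<forall>u\<in>Poly_Mapping.keys q. \<exists>v\<in>V. mon_dvd v u"
      using p q keys_add[of p q] by blast
  qed simp
  moreover have "xpow ` V \<subseteq> ?J" using V by (auto intro: mon_dvd_refl)
  ultimately show thesis using mpoly_ideal_minimal[of ?J n "xpow ` V"] p u that by blast
qed

text \<open>Reduces an inclusion of initial ideals to divisibility between leading
  exponents.\<close>

lemma monomial_ideal_mono:
  assumes W: "W \<subseteq> monomials n" and V: "V \<subseteq> monomials n"
    and dvd: "\<And>v. v \<in> V \<Longrightarrow> \<exists>w\<in>W. mon_dvd w v"
  shows "mpoly_ideal n (xpow ` V :: 'k::field mpoly set) \<subseteq> mpoly_ideal n (xpow ` W)"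
proof (rule mpoly_ideal_minimal)
  have car: "(xpow ` W :: 'k mpoly set) \<subseteq> {p. Poly_Mapping.keys p \<subseteq> monomials n}"
    using W by auto
  then show I: "ideal (mpoly_ideal n (xpow ` W :: 'k mpoly set)) (mpoly_ring n)"
    by (rule mpoly_ideal_ideal)
  show "(xpow ` V :: 'k mpoly set) \<subseteq> mpoly_ideal n (xpow ` W)"
  proof
    fix p :: "'k mpoly" assume "p \<in> xpow ` V"
    then obtain v w where v: "v \<in> V" "p = xpow v" and w: "w \<in> W" "mon_dvd w v"
      using dvd by blast
    have "(xpow (v - w) :: 'k mpoly) * xpow w = xpow ((v - w) + w)"
      by (simp add: mult_single)
    also have "(v - w) + w = v" using mon_dvd_add_diff[OF w(2)] by (simp add: add.commute)
    finally have "p = xpow (v - w) * xpow w" using v by simp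
    moreover have "xpow w \<in> mpoly_ideal n (xpow ` W :: 'k mpoly set)"
      using mpoly_ideal_self[OF car] w(1) by blast
    moreover have "(xpow (v - w) :: 'k mpoly) \<in> carrier (mpoly_ring n)"
      using v V by (auto intro: monomials_diff)
    ultimately show "p \<in> mpoly_ideal n (xpow ` W)"
      using ideal.I_l_closed[OF I, of "xpow w" "xpow (v - w)"] by simp
  qed
qed

subsection \<open>Reduced Groebner bases of toric ideals\<close>

definition mon_deg :: "int mat \<Rightarrow> mon \<Rightarrow> int vec" where
  "mon_deg A u = A *\<^sub>v vec_of_mon (dim_col A) u"

lemma vec_of_mon_carrier [simp]: "vec_of_mon n u \<in> carrier_vec n"
  by (simp add: vec_of_mon_def)

lemma mon_deg_carrier [simp]: "mon_deg A u \<in> carrier_vec (dim_row A)"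
  by (intro carrier_vecI) (simp add: mon_deg_def)

lemma vec_of_mon_add: "vec_of_mon n (u + v) = vec_of_mon n u + vec_of_mon n v"
  by (auto simp: vec_of_mon_def lookup_add)

lemma mon_deg_add: "mon_deg A (u + v) = mon_deg A u + mon_deg A v"
  unfolding mon_deg_def vec_of_mon_add
  by (intro mult_add_distrib_mat_vec[of _ "dim_row A" "dim_col A"]) auto

lemma mon_deg_add_left_cancel: "mon_deg A (m + u) = mon_deg A (m + v) \<longleftrightarrow> mon_deg A u = mon_deg A v"
  using mon_deg_carrier[of A u] mon_deg_carrier[of A v] mon_deg_carrier[of A m]
  unfolding mon_deg_add by (auto simp: vec_eq_iff)

text \<open>The coefficient at \<open>b\<close> of the image of \<open>p\<close> under the
  substitution that sends x^u to t^(Au). The toric ideal is annihilated by this substitution, and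
  that is the invariant used for membership.\<close>

definition fiber_sum :: "int mat \<Rightarrow> int vec \<Rightarrow> 'k::field mpoly \<Rightarrow> 'k" where
  "fiber_sum A b p = (\<Sum>u\<in>{u \<in> Poly_Mapping.keys p. mon_deg A u = b}. Poly_Mapping.lookup p u)"

lemma fiber_sum_superset:
  assumes "finite F" "Poly_Mapping.keys p \<subseteq> F"
  shows "fiber_sum A b p = (\<Sum>u\<in>{u \<in> F. mon_deg A u = b}. Poly_Mapping.lookup p u)"
  unfolding fiber_sum_def using assms
  by (intro sum.mono_neutral_left) (auto simp: in_keys_iff)

lemma fiber_sum_zero [simp]: "fiber_sum A b 0 = 0"
  by (simp add: fiber_sum_def)

lemma fiber_sum_add: "fiber_sum A b (p + q) = fiber_sum A b p + fiber_sum A b q"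
proof -
  let ?F = "Poly_Mapping.keys p \<union> Poly_Mapping.keys q"
  have "finite ?F" "Poly_Mapping.keys p \<subseteq> ?F" "Poly_Mapping.keys q \<subseteq> ?F"
    "Poly_Mapping.keys (p + q) \<subseteq> ?F" using keys_add[of p q] by auto
  then show ?thesis
    by (simp add: fiber_sum_superset[of ?F] lookup_add sum.distrib)
qed

lemma fiber_sum_sum: "finite I \<Longrightarrow> fiber_sum A b (\<Sum>i\<in>I. f i) = (\<Sum>i\<in>I. fiber_sum A b (f i))"
  by (induction I rule: finite_induct) (auto simp: fiber_sum_add)

lemma fiber_sum_single: "fiber_sum A b (Poly_Mapping.single u c) = (if mon_deg A u = b then c else 0)"
proof -
  have "fiber_sum A b (Poly_Mapping.single u c) =
      (\<Sum>v\<in>{v \<in> {u}. mon_deg A v = b}. Poly_Mapping.lookup (Poly_Mapping.single u c) v)"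
    by (rule fiber_sum_superset) auto
  also have "{v \<in> {u}. mon_deg A v = b} = (if mon_deg A u = b then {u} else {})" by auto
  finally show ?thesis by simp
qed

lemma mpoly_sum_monomials:
  "(\<Sum>u\<in>Poly_Mapping.keys p. Poly_Mapping.single u (Poly_Mapping.lookup p u)) = p"
  by (rule poly_mapping_eqI)
    (auto simp: lookup_sum lookup_single when_def in_keys_iff)

text \<open>Multiplication by a monomial \<open>m\<close> shifts fibers. The terms of
  \<open>p\<close> shifted into the fiber of \<open>b\<close> are none at all, or exactly the fiber
  of any one such term \<open>u0\<close>, whose sum vanishes by assumption.\<close>

lemma fiber_sum_mult:
  assumes p: "\<And>b. fiber_sum A b p = 0"
  shows "fiber_sum A b (q * p) = 0"
proof -
  have m: "(\<Sum>u\<in>Poly_Mapping.keys p. if mon_deg A (m + u) = b then Poly_Mapping.lookup p u else 0) = 0"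
    for m
  proof (cases "\<exists>u\<in>Poly_Mapping.keys p. mon_deg A (m + u) = b")
    case True
    then obtain u0 where b: "mon_deg A (m + u0) = b" by blast
    have "(\<Sum>u\<in>Poly_Mapping.keys p. if mon_deg A (m + u) = b then Poly_Mapping.lookup p u else 0)
        = fiber_sum A (mon_deg A u0) p"
      unfolding fiber_sum_def b[symmetric] mon_deg_add_left_cancel
      by (simp add: sum.If_cases Int_def)
    then show ?thesis using p by simp
  next
    case False
    then show ?thesis by (auto intro!: sum.neutral)
  qed
  have "q * p = (\<Sum>m\<in>Poly_Mapping.keys q. Poly_Mapping.single m (Poly_Mapping.lookup q m)) *
      (\<Sum>u\<in>Poly_Mapping.keys p. Poly_Mapping.single u (Poly_Mapping.lookup p u))"
    unfolding mpoly_sum_monomials ..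
  also have "\<dots> = (\<Sum>m\<in>Poly_Mapping.keys q. \<Sum>u\<in>Poly_Mapping.keys p.
      Poly_Mapping.single (m + u) (Poly_Mapping.lookup q m * Poly_Mapping.lookup p u))"
    by (simp add: sum_product mult_single)
  finally have "fiber_sum A b (q * p) = (\<Sum>m\<in>Poly_Mapping.keys q. \<Sum>u\<in>Poly_Mapping.keys p.
      if mon_deg A (m + u) = b then Poly_Mapping.lookup q m * Poly_Mapping.lookup p u else 0)"
    by (simp add: fiber_sum_sum fiber_sum_single)
  also have "\<dots> = (\<Sum>m\<in>Poly_Mapping.keys q. Poly_Mapping.lookup q m *
      (\<Sum>u\<in>Poly_Mapping.keys p. if mon_deg A (m + u) = b then Poly_Mapping.lookup p u else 0))"
    by (auto simp: sum_distrib_left intro!: sum.cong)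
  finally show ?thesis by (simp add: m)
qed

lemma toric_generators_carrier:
  "{xpow u - xpow v | u v. u \<in> monomials n \<and> v \<in> monomials n \<and>
       A *\<^sub>v vec_of_mon n u = A *\<^sub>v vec_of_mon n v}
    \<subseteq> {p :: 'k::field mpoly. Poly_Mapping.keys p \<subseteq> monomials n}"
proof clarify
  fix u v w assume uv: "u \<in> monomials n" "v \<in> monomials n"
    and w: "w \<in> Poly_Mapping.keys (xpow u - xpow v :: 'k mpoly)"
  then have "w = u \<or> w = v" by (auto simp: in_keys_iff lookup_minus lookup_single when_def split: if_splits)
  then show "w \<in> monomials n" using uv by auto
qed

lemma toric_ideal_fiber_sum:
  assumes "p \<in> toric_ideal A"
  shows "Poly_Mapping.keys p \<subseteq> monomials (dim_col A)" "fiber_sum A b p = 0"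
proof -
  let ?n = "dim_col A"
  let ?J = "{p :: 'a mpoly. Poly_Mapping.keys p \<subseteq> monomials ?n \<and> (\<forall>b. fiber_sum A b p = 0)}"
  have "ideal ?J (mpoly_ring ?n)"
    by (rule mpoly_idealI) (simp_all add: mpoly_carrier_add mpoly_carrier_mult fiber_sum_add fiber_sum_mult)
  moreover have "{xpow u - xpow v | u v. u \<in> monomials ?n \<and> v \<in> monomials ?n \<and>
       A *\<^sub>v vec_of_mon ?n u = A *\<^sub>v vec_of_mon ?n v} \<subseteq> ?J" (is "?S \<subseteq> _")
  proof
    fix p :: "'a mpoly" assume p: "p \<in> ?S"
    then obtain u v where uv: "p = xpow u - xpow v" "mon_deg A u = mon_deg A v"
      unfolding mon_deg_def by blast
    have "p = xpow u + Poly_Mapping.single v (- 1)" by (simp add: uv(1) single_uminus)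
    then have "fiber_sum A b p = 0" for b
      using uv(2) by (simp add: fiber_sum_add fiber_sum_single)
    moreover have "Poly_Mapping.keys p \<subseteq> monomials ?n"
      using toric_generators_carrier p by blast
    ultimately show "p \<in> ?J" by blast
  qed
  ultimately have "p \<in> ?J"
    using mpoly_ideal_minimal[of ?J ?n ?S] assms unfolding toric_ideal_def Let_def by blast
  then show "Poly_Mapping.keys p \<subseteq> monomials (dim_col A)" "fiber_sum A b p = 0" by auto
qed

lemma toric_binomial_mem:
  assumes "u \<in> monomials (dim_col A)" "v \<in> monomials (dim_col A)" "mon_deg A u = mon_deg A v"
  shows "xpow u - xpow v \<in> toric_ideal A"
  using mpoly_ideal_self[OF toric_generators_carrier] assms
  unfolding toric_ideal_def mon_deg_def Let_def by blast

text \<open>A term alone in its fiber would make that fiber sum equal to its own nonzero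
  coefficient.\<close>

lemma toric_ideal_key_partner:
  assumes p: "p \<in> toric_ideal A" and u: "u \<in> Poly_Mapping.keys p"
  obtains v where "v \<in> Poly_Mapping.keys p" "v \<noteq> u" "mon_deg A v = mon_deg A u"
proof (rule ccontr)
  assume *: "\<not> thesis"
  then have "{v \<in> Poly_Mapping.keys p. mon_deg A v = mon_deg A u} = {u}"
    using u that by auto
  then have "fiber_sum A (mon_deg A u) p = Poly_Mapping.lookup p u"
    by (simp add: fiber_sum_def)
  then show False using toric_ideal_fiber_sum(2)[OF p] u by (simp add: in_keys_iff)
qed

section \<open>Term orders and leading monomials\<close>

lemma term_orderD:
  assumes "term_order n r"
  shows "u \<in> monomials n \<Longrightarrow> (u, u) \<in> r"
    "(u, v) \<in> r \<Longrightarrow> (v, w) \<in> r \<Longrightarrow> (u, w) \<in> r"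
    "(u, v) \<in> r \<Longrightarrow> (v, u) \<in> r \<Longrightarrow> u = v"
    "u \<in> monomials n \<Longrightarrow> v \<in> monomials n \<Longrightarrow> (u, v) \<in> r \<or> (v, u) \<in> r"
    "(u, v) \<in> r \<Longrightarrow> w \<in> monomials n \<Longrightarrow> (u + w, v + w) \<in> r"
    "u \<in> monomials n \<Longrightarrow> (0, u) \<in> r"
proof -
  have L: "refl_on (monomials n) r" "trans r" "antisym r" "total_on (monomials n) r"
    and T: "\<forall>u\<in>monomials n. (0, u) \<in> r"
      "\<forall>u v. \<forall>w\<in>monomials n. (u, v) \<in> r \<longrightarrow> (u + w, v + w) \<in> r"
    using assms
    by (auto simp: term_order_def linear_order_on_def partial_order_on_def preorder_on_def)
  show refl: "u \<in> monomials n \<Longrightarrow> (u, u) \<in> r" using L(1) by (rule refl_onD)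
  show "(u, v) \<in> r \<Longrightarrow> (v, w) \<in> r \<Longrightarrow> (u, w) \<in> r" using L(2) by (rule transD)
  show "(u, v) \<in> r \<Longrightarrow> (v, u) \<in> r \<Longrightarrow> u = v" using L(3) by (rule antisymD)
  show "u \<in> monomials n \<Longrightarrow> v \<in> monomials n \<Longrightarrow> (u, v) \<in> r \<or> (v, u) \<in> r"
    using L(4) refl by (cases "u = v") (auto simp: total_on_def)
  show "(u, v) \<in> r \<Longrightarrow> w \<in> monomials n \<Longrightarrow> (u + w, v + w) \<in> r" using T(2) by blast
  show "u \<in> monomials n \<Longrightarrow> (0, u) \<in> r" using T(1) by blast
qed

lemma term_order_dvd:
  assumes "term_order n r" "v \<in> monomials n" "mon_dvd u v"
  shows "(u, v) \<in> r"
proof -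
  have "(0 + u, (v - u) + u) \<in> r"
    using assms by (intro term_orderD(5)[OF assms(1)] term_orderD(6)[OF assms(1)])
      (auto intro: monomials_diff monomials_dvd)
  then show ?thesis using mon_dvd_add_diff[OF assms(3)] by (simp add: add.commute)
qed

lemma finite_total_trans_max:
  assumes "finite S" "S \<noteq> {}" and trans: "\<And>u v w. (u, v) \<in> r \<Longrightarrow> (v, w) \<in> r \<Longrightarrow> (u, w) \<in> r"
    and total: "\<And>u v. u \<in> S \<Longrightarrow> v \<in> S \<Longrightarrow> (u, v) \<in> r \<or> (v, u) \<in> r"
  shows "\<exists>u\<in>S. \<forall>v\<in>S. (v, u) \<in> r"
  using assms(1,2) total
proof (induction S rule: finite_ne_induct)
  case (singleton x)
  then show ?case by auto
next
  case (insert x F)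
  then obtain u where u: "u \<in> F" "\<forall>v\<in>F. (v, u) \<in> r" by blast
  have "(x, u) \<in> r \<or> (u, x) \<in> r" using insert.prems u(1) by blast
  then show ?case
  proof
    assume "(x, u) \<in> r"
    then show ?thesis using u by (intro bexI[of _ u]) auto
  next
    assume "(u, x) \<in> r"
    then have "\<forall>v\<in>F. (v, x) \<in> r" using u(2) trans by blast
    then show ?thesis using insert.prems[of x x] by (intro bexI[of _ x]) auto
  qed
qed

text \<open>Well-foundedness via Dickson: the least of the finitely many divisibility-minimal
  members lies below everything, because a divisor precedes its multiples.\<close>

lemma term_order_least:
  assumes r: "term_order n r" and S: "S \<noteq> {}" "S \<subseteq> monomials n"
  obtains u where "u \<in> S" "\<forall>v\<in>S. (u, v) \<in> r"
proof -
  obtain u0 where "u0 \<in> S" using S by blast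
  then obtain u1 where u1: "u1 \<in> minimal_mons S" using minimal_mons_below[OF S(2)] by blast
  have sub: "minimal_mons S \<subseteq> S" by (auto simp: minimal_mons_def)
  have "\<exists>u\<in>minimal_mons S. \<forall>v\<in>minimal_mons S. (v, u) \<in> r\<inverse>"
  proof (rule finite_total_trans_max)
    show "(u, v) \<in> r\<inverse> \<or> (v, u) \<in> r\<inverse>" if "u \<in> minimal_mons S" "v \<in> minimal_mons S" for u v
      using term_orderD(4)[OF r, of u v] that sub S(2) by blast
  qed (use finite_minimal_mons[OF S(2)] u1 term_orderD(2)[OF r] in blast)+
  then obtain u where u: "u \<in> minimal_mons S" "\<forall>v\<in>minimal_mons S. (u, v) \<in> r" by blast
  have "(u, v) \<in> r" if v: "v \<in> S" for v
  proof -
    obtain v' where v': "v' \<in> minimal_mons S" "mon_dvd v' v"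
      using minimal_mons_below[OF S(2) v] .
    then have "(v', v) \<in> r" using term_order_dvd[OF r] v S(2) by blast
    then show ?thesis using u(2) v'(1) term_orderD(2)[OF r] by blast
  qed
  then show thesis using that u(1) sub by blast
qed

lemma lead_mon_eqI:
  assumes r: "term_order n r" and "u \<in> Poly_Mapping.keys p" "\<forall>v\<in>Poly_Mapping.keys p. (v, u) \<in> r"
  shows "lead_mon r p = u"
  unfolding lead_mon_def using assms(2,3) term_orderD(3)[OF r] by (intro the_equality) auto

lemma lead_mon_max:
  assumes r: "term_order n r" and p: "p \<noteq> 0" "Poly_Mapping.keys p \<subseteq> monomials n"
  shows "lead_mon r p \<in> Poly_Mapping.keys p" "v \<in> Poly_Mapping.keys p \<Longrightarrow> (v, lead_mon r p) \<in> r"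
proof -
  have "\<exists>u\<in>Poly_Mapping.keys p. \<forall>v\<in>Poly_Mapping.keys p. (v, u) \<in> r"
  proof (rule finite_total_trans_max)
    show "Poly_Mapping.keys p \<noteq> {}" using p(1) by simp
    show "(u, v) \<in> r \<or> (v, u) \<in> r" if "u \<in> Poly_Mapping.keys p" "v \<in> Poly_Mapping.keys p" for u v
      using term_orderD(4)[OF r, of u v] that p(2) by blast
  qed (use term_orderD(2)[OF r] in auto)
  then obtain u where u: "u \<in> Poly_Mapping.keys p" "\<forall>v\<in>Poly_Mapping.keys p. (v, u) \<in> r" by blast
  then have "lead_mon r p = u" by (rule lead_mon_eqI[OF r])
  then show "lead_mon r p \<in> Poly_Mapping.keys p"
    "v \<in> Poly_Mapping.keys p \<Longrightarrow> (v, lead_mon r p) \<in> r" using u by auto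
qed

lemma keys_binomial: "u \<noteq> v \<Longrightarrow> Poly_Mapping.keys (xpow u - xpow v :: 'k::field mpoly) = {u, v}"
  by (auto simp: in_keys_iff lookup_minus lookup_single when_def split: if_splits)

lemma lead_mon_binomial:
  assumes r: "term_order n r" and "u \<noteq> v" "(v, u) \<in> r" "u \<in> monomials n"
  shows "lead_mon r (xpow u - xpow v :: 'k::field mpoly) = u"
  using assms term_orderD(1)[OF r] by (intro lead_mon_eqI[OF r]) (auto simp: keys_binomial)

section \<open>Standard monomials and an explicit reduced basis\<close>

definition nonstandard :: "int mat \<Rightarrow> mon rel \<Rightarrow> mon set" where
  "nonstandard A r = {u \<in> monomials (dim_col A).
     \<exists>v\<in>monomials (dim_col A). mon_deg A v = mon_deg A u \<and> v \<noteq> u \<and> (v, u) \<in> r}"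

text \<open>The least monomial of the fiber of \<open>u\<close>, which is the remainder of x^u
  modulo any Groebner basis of the toric ideal. All other monomials of the fiber are
  \<open>nonstandard\<close>, that is, exponents in the initial ideal.\<close>

definition normal_form :: "int mat \<Rightarrow> mon rel \<Rightarrow> mon \<Rightarrow> mon" where
  "normal_form A r u = (THE v. v \<in> monomials (dim_col A) \<and> mon_deg A v = mon_deg A u \<and>
     (\<forall>w\<in>monomials (dim_col A). mon_deg A w = mon_deg A u \<longrightarrow> (v, w) \<in> r))"

definition toric_reduced_basis :: "int mat \<Rightarrow> mon rel \<Rightarrow> 'k::field mpoly set" where
  "toric_reduced_basis A r =
     (\<lambda>u. xpow u - xpow (normal_form A r u)) ` minimal_mons (nonstandard A r)"

context
  fixes A :: "int mat" and r :: "mon rel"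
  assumes r: "term_order (dim_col A) r"
begin

lemma normal_form_eqI:
  assumes "v \<in> monomials (dim_col A)" "mon_deg A v = mon_deg A u"
    "\<And>w. w \<in> monomials (dim_col A) \<Longrightarrow> mon_deg A w = mon_deg A u \<Longrightarrow> (v, w) \<in> r"
  shows "normal_form A r u = v"
  unfolding normal_form_def using assms term_orderD(3)[OF r] by (intro the_equality) auto

lemma normal_form_least:
  assumes u: "u \<in> monomials (dim_col A)"
  shows "normal_form A r u \<in> monomials (dim_col A)" "mon_deg A (normal_form A r u) = mon_deg A u"
    "w \<in> monomials (dim_col A) \<Longrightarrow> mon_deg A w = mon_deg A u \<Longrightarrow> (normal_form A r u, w) \<in> r"
proof -
  obtain v where v: "v \<in> {v \<in> monomials (dim_col A). mon_deg A v = mon_deg A u}"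
    "\<forall>w\<in>{v \<in> monomials (dim_col A). mon_deg A v = mon_deg A u}. (v, w) \<in> r"
    by (rule term_order_least[OF r, of "{v \<in> monomials (dim_col A). mon_deg A v = mon_deg A u}"])
      (use u in auto)
  then have "normal_form A r u = v" by (intro normal_form_eqI) auto
  then show "normal_form A r u \<in> monomials (dim_col A)" "mon_deg A (normal_form A r u) = mon_deg A u"
    "w \<in> monomials (dim_col A) \<Longrightarrow> mon_deg A w = mon_deg A u \<Longrightarrow> (normal_form A r u, w) \<in> r"
    using v by auto
qed

lemma normal_form_standard: "u \<in> monomials (dim_col A) \<Longrightarrow> normal_form A r u \<notin> nonstandard A r"
  using normal_form_least[of u] term_orderD(3)[OF r] by (force simp: nonstandard_def)

lemma normal_form_below:
  assumes "u \<in> nonstandard A r"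
  shows "normal_form A r u \<noteq> u" "(normal_form A r u, u) \<in> r"
proof -
  have u: "u \<in> monomials (dim_col A)" using assms by (simp add: nonstandard_def)
  show "normal_form A r u \<noteq> u" using normal_form_standard[OF u] assms by metis
  show "(normal_form A r u, u) \<in> r" using normal_form_least[OF u] u by blast
qed

text \<open>Multiplying \<open>u\<close> and a smaller monomial of its fiber by the same cofactor
  keeps both the fiber relation and the order.\<close>

lemma nonstandard_up:
  assumes u: "u \<in> nonstandard A r" and w: "mon_dvd u w" "w \<in> monomials (dim_col A)"
  shows "w \<in> nonstandard A r"
proof -
  obtain v where v: "v \<in> monomials (dim_col A)" "mon_deg A v = mon_deg A u" "v \<noteq> u" "(v, u) \<in> r"
    using u by (auto simp: nonstandard_def)
  have d: "w - u \<in> monomials (dim_col A)" using w(2) by (rule monomials_diff)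
  have w': "u + (w - u) = w" using w(1) by (rule mon_dvd_add_diff)
  have "(v + (w - u), u + (w - u)) \<in> r" using term_orderD(5)[OF r v(4) d] .
  moreover have "v + (w - u) \<noteq> u + (w - u)" using v(3) by simp
  moreover have "mon_deg A (v + (w - u)) = mon_deg A (u + (w - u))" using v(2) by (simp add: mon_deg_add)
  ultimately show ?thesis
    using monomials_add[OF v(1) d] w(2) unfolding w' nonstandard_def by blast
qed

text \<open>The leading term shares its fiber with another term, which is smaller.\<close>

lemma lead_mon_toric:
  assumes f: "f \<in> toric_ideal A" "f \<noteq> 0"
  shows "lead_mon r f \<in> nonstandard A r"
proof -
  note k = toric_ideal_fiber_sum(1)[OF f(1)]
  note l = lead_mon_max[OF r f(2) k]
  obtain v where "v \<in> Poly_Mapping.keys f" "v \<noteq> lead_mon r f" "mon_deg A v = mon_deg A (lead_mon r f)"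
    using toric_ideal_key_partner[OF f(1) l(1)] .
  then show ?thesis using k l by (auto simp: nonstandard_def)
qed

lemma initial_ideal_eq: "initial_ideal n r F = mpoly_ideal n (xpow ` lead_mon r ` (F - {0}))"
  unfolding initial_ideal_def by (rule arg_cong[where f = "mpoly_ideal n"]) auto

lemma nonstandard_monomials: "nonstandard A r \<subseteq> monomials (dim_col A)"
  by (auto simp: nonstandard_def)

lemma lead_mon_reduced_binomial:
  assumes "u \<in> nonstandard A r"
  shows "lead_mon r (xpow u - xpow (normal_form A r u) :: 'k::field mpoly) = u"
  using normal_form_below[OF assms] nonstandard_monomials assms
  by (intro lead_mon_binomial[OF r]) auto

text \<open>Leading monomials of the ideal are nonstandard, hence divisible by a minimal nonstandard
  monomial, and each of those leads a binomial of the proposed basis.\<close>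

lemma toric_reduced_basis_groebner:
  "groebner_basis (dim_col A) r (toric_ideal A) (toric_reduced_basis A r :: 'k::field mpoly set)"
  (is "groebner_basis ?n r ?I ?G")
  unfolding groebner_basis_def
proof (intro conjI)
  let ?M = "nonstandard A r"
  have min: "minimal_mons ?M \<subseteq> ?M" by (auto simp: minimal_mons_def)
  show "finite ?G"
    using finite_minimal_mons[OF nonstandard_monomials] by (simp add: toric_reduced_basis_def)
  show GI: "?G \<subseteq> ?I"
    unfolding toric_reduced_basis_def
    using min nonstandard_monomials normal_form_least(1,2)
    by (auto intro!: toric_binomial_mem)
  have leadI: "lead_mon r ` (?I - {0}) \<subseteq> ?M" using lead_mon_toric by auto
  then have leadG: "lead_mon r ` (?G - {0}) \<subseteq> ?M" using GI by auto
  show "initial_ideal ?n r ?G = initial_ideal ?n r ?I"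
    unfolding initial_ideal_eq
  proof (intro equalityI monomial_ideal_mono)
    show "\<exists>w\<in>lead_mon r ` (?I - {0}). mon_dvd w v" if "v \<in> lead_mon r ` (?G - {0})" for v
      using that GI by (intro bexI[of _ v]) auto
    show "\<exists>w\<in>lead_mon r ` (?G - {0}). mon_dvd w v" if v: "v \<in> lead_mon r ` (?I - {0})" for v
    proof -
      obtain u where u: "u \<in> minimal_mons ?M" "mon_dvd u v"
        using minimal_mons_below[OF nonstandard_monomials] v leadI by blast
      let ?g = "xpow u - xpow (normal_form A r u) :: 'k mpoly"
      have uM: "u \<in> ?M" using u min by blast
      have "Poly_Mapping.keys ?g = {u, normal_form A r u}"
        using normal_form_below[OF uM] by (intro keys_binomial) auto
      then have "?g \<noteq> 0" by auto
      moreover have "?g \<in> ?G" using u(1) by (simp add: toric_reduced_basis_def)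
      moreover have "lead_mon r ?g = u" using uM by (rule lead_mon_reduced_binomial)
      ultimately have "u \<in> lead_mon r ` (?G - {0})" by (metis Diff_iff imageI singletonD)
      then show ?thesis using u(2) by blast
    qed
  qed (use leadI leadG nonstandard_monomials in blast)+
qed

text \<open>Leading monomials do not divide each other by minimality. They do not divide a tail
  either, since tails are standard and multiples of nonstandard monomials are nonstandard.\<close>

lemma toric_reduced_basis_reduced:
  "reduced_groebner_basis (dim_col A) r (toric_ideal A) (toric_reduced_basis A r :: 'k::field mpoly set)"
proof -
  let ?M = "nonstandard A r"
  have min: "minimal_mons ?M \<subseteq> ?M" by (auto simp: minimal_mons_def)
  let ?g = "\<lambda>u. xpow u - xpow (normal_form A r u) :: 'k mpoly"
  have keys: "Poly_Mapping.keys (?g u) = {u, normal_form A r u}" if "u \<in> ?M" for u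
    using normal_form_below[OF that] by (intro keys_binomial) auto
  have lead: "lead_mon r (?g u) = u" if "u \<in> ?M" for u
    using that by (rule lead_mon_reduced_binomial)
  have "?g u \<noteq> 0 \<and> Poly_Mapping.lookup (?g u) (lead_mon r (?g u)) = 1" if "u \<in> minimal_mons ?M" for u
  proof -
    have u: "u \<in> ?M" using that min by blast
    have "Poly_Mapping.lookup (?g u) u = 1"
      using normal_form_below[OF u] by (simp add: lookup_minus lookup_single)
    then show ?thesis using lead[OF u] by auto
  qed
  moreover have "\<not> mon_dvd (lead_mon r (?g u)) w"
    if u: "u \<in> minimal_mons ?M" and v: "v \<in> minimal_mons ?M" and ne: "?g u \<noteq> ?g v"
      and w: "w \<in> Poly_Mapping.keys (?g v)" for u v w
  proof
    assume dvd: "mon_dvd (lead_mon r (?g u)) w"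
    have uM: "u \<in> ?M" and vM: "v \<in> ?M" using u v min by auto
    have vm: "v \<in> monomials (dim_col A)" using vM nonstandard_monomials by blast
    have du: "mon_dvd u w" using dvd lead[OF uM] by simp
    have "w = v \<or> w = normal_form A r v" using w keys[OF vM] by blast
    then show False
    proof
      assume "w = v"
      then have "u = v" using du u v by (auto simp: minimal_mons_def)
      then show False using ne by simp
    next
      assume "w = normal_form A r v"
      then show False
        using nonstandard_up[OF uM du] normal_form_least(1)[OF vm] normal_form_standard[OF vm] by simp
    qed
  qed
  ultimately show ?thesis
    unfolding reduced_groebner_basis_def using toric_reduced_basis_groebner
    by (auto simp: toric_reduced_basis_def)
qed

text \<open>Equality of the initial ideals carries divisibility over to an arbitrary reduced basis
  \<open>G\<close>; the universal Groebner basis quantifies over all of them.\<close>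

lemma reduced_basis_lead_dvd:
  assumes G: "reduced_groebner_basis (dim_col A) r (toric_ideal A) (G :: 'k::field mpoly set)"
    and f: "(f :: 'k mpoly) \<in> toric_ideal A" "f \<noteq> 0"
  obtains g where "g \<in> G" "mon_dvd (lead_mon r g) (lead_mon r f)"
proof -
  have GI: "G \<subseteq> toric_ideal A" and
    eq: "initial_ideal (dim_col A) r G = initial_ideal (dim_col A) r (toric_ideal A :: 'k mpoly set)"
    using G by (auto simp: reduced_groebner_basis_def groebner_basis_def)
  have I: "lead_mon r ` (toric_ideal A - {0 :: 'k mpoly}) \<subseteq> monomials (dim_col A)"
    using lead_mon_toric nonstandard_monomials by blast
  then have car: "(xpow ` lead_mon r ` (toric_ideal A - {0 :: 'k mpoly}) :: 'k mpoly set)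
      \<subseteq> {p. Poly_Mapping.keys p \<subseteq> monomials (dim_col A)}"
    unfolding image_subset_iff by auto
  have "xpow (lead_mon r f) \<in> (xpow ` lead_mon r ` (toric_ideal A - {0 :: 'k mpoly}) :: 'k mpoly set)"
    using f by blast
  then have "xpow (lead_mon r f) \<in> initial_ideal (dim_col A) r (toric_ideal A :: 'k mpoly set)"
    unfolding initial_ideal_eq by (rule subsetD[OF mpoly_ideal_self[OF car]])
  then have mem: "xpow (lead_mon r f) \<in> mpoly_ideal (dim_col A) (xpow ` lead_mon r ` (G - {0}) :: 'k mpoly set)"
    unfolding eq[symmetric] by (simp only: initial_ideal_eq)
  have "lead_mon r ` (G - {0}) \<subseteq> monomials (dim_col A)" using I GI by blast
  from monomial_ideal_dvd[OF this mem, of "lead_mon r f"]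
  obtain v where "v \<in> lead_mon r ` (G - {0})" "mon_dvd v (lead_mon r f)" by auto
  then show thesis using that by blast
qed

end

subsection \<open>Elements of the universal Groebner basis\<close>

lemma lookup_pos_mon: "Poly_Mapping.lookup (pos_mon w) i = (if i < dim_vec w then nat (w $ i) else 0)"
  by (rule pos_mon.rep_eq[THEN fun_cong])

lemma pos_mon_monomials: "w \<in> carrier_vec n \<Longrightarrow> pos_mon w \<in> monomials n"
  by (auto simp: monomials_iff lookup_pos_mon)

lemma vec_of_mon_pos_mon:
  "w \<in> carrier_vec n \<Longrightarrow> vec_of_mon n (pos_mon w) - vec_of_mon n (pos_mon (- w)) = w"
  by (auto simp: vec_of_mon_def lookup_pos_mon vec_eq_iff)

lemma minus_eq_zero_vec_iff:
  "a \<in> carrier_vec n \<Longrightarrow> b \<in> carrier_vec n \<Longrightarrow> a - b = 0\<^sub>v n \<longleftrightarrow> a = (b :: int vec)"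
  by (auto simp: vec_eq_iff)

lemma mat_kernel_iff_mon_deg:
  assumes w: "w \<in> carrier_vec (dim_col A)"
  shows "w \<in> mat_kernel A \<longleftrightarrow> mon_deg A (pos_mon w) = mon_deg A (pos_mon (- w))"
proof -
  have "A *\<^sub>v w = A *\<^sub>v (vec_of_mon (dim_col A) (pos_mon w) - vec_of_mon (dim_col A) (pos_mon (- w)))"
    using vec_of_mon_pos_mon[OF w] by simp
  also have "\<dots> = mon_deg A (pos_mon w) - mon_deg A (pos_mon (- w))"
    unfolding mon_deg_def
    by (intro mult_minus_distrib_mat_vec[of _ "dim_row A" "dim_col A"]) auto
  finally have "A *\<^sub>v w = 0\<^sub>v (dim_row A) \<longleftrightarrow> mon_deg A (pos_mon w) = mon_deg A (pos_mon (- w))"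
    using minus_eq_zero_vec_iff[OF mon_deg_carrier mon_deg_carrier] by simp
  then show ?thesis using w by (simp add: mat_kernel_def)
qed

lemma pos_mon_eq_uminus:
  assumes w: "w \<in> carrier_vec n" and eq: "pos_mon w = pos_mon (- w)"
  shows "w = 0\<^sub>v n"
proof (rule eq_vecI)
  fix i assume "i < dim_vec (0\<^sub>v n :: int vec)"
  then have i: "i < n" by simp
  have "Poly_Mapping.lookup (pos_mon w) i = Poly_Mapping.lookup (pos_mon (- w)) i" using eq by simp
  then show "w $ i = 0\<^sub>v n $ i" using w i by (auto simp: lookup_pos_mon split: if_splits)
qed (use w in auto)

lemma pos_mon_disjoint: "mon_dvd (pos_mon w) (pos_mon (- w)) \<Longrightarrow> pos_mon w = 0"
proof (rule poly_mapping_eqI)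
  fix i assume "mon_dvd (pos_mon w) (pos_mon (- w))"
  then have "Poly_Mapping.lookup (pos_mon w) i \<le> Poly_Mapping.lookup (pos_mon (- w)) i"
    by (simp add: mon_dvd_def)
  then show "Poly_Mapping.lookup (pos_mon w) i = Poly_Mapping.lookup 0 i"
    by (auto simp: lookup_pos_mon split: if_splits)
qed

lemma conformal_pos_mon: "conformal v w \<Longrightarrow> mon_dvd (pos_mon v) (pos_mon w)"
  unfolding mon_dvd_def lookup_pos_mon conformal_def by force

lemma conformal_pos_mon_add:
  assumes c: "conformal v w"
  shows "pos_mon v + pos_mon (w - v) = pos_mon w"
proof (rule poly_mapping_eqI)
  fix i
  have "nat (v $ i) + nat ((w - v) $ i) = nat (w $ i)" if "i < dim_vec w"
    using c that unfolding conformal_def by force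
  then show "Poly_Mapping.lookup (pos_mon v + pos_mon (w - v)) i = Poly_Mapping.lookup (pos_mon w) i"
    using c by (simp add: lookup_add lookup_pos_mon conformal_def)
qed

text \<open>
  Each of \<open>a\<close> and \<open>w - a\<close> below yields a toric binomial whose leading monomial must be divisible
  by that of \<open>w\<close>, so \<open>a\<^sup>+ = w\<^sup>+ = (w - a)\<^sup>+\<close>.
\<close>

lemma reduced_basis_element_primitive:
  assumes r: "term_order (dim_col A) r"
    and G: "reduced_groebner_basis (dim_col A) r (toric_ideal A) (G :: 'k::field mpoly set)"
    and g: "g \<in> G" "Poly_Mapping.keys g = {pos_mon w, pos_mon (- w)}" "lead_mon r g = pos_mon w"
    and w: "w \<in> carrier_vec (dim_col A)"
  shows "primitive A w"
proof -
  let ?n = "dim_col A"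
  have GI: "G \<subseteq> toric_ideal A"
    and red: "\<And>h u. h \<in> G \<Longrightarrow> h \<noteq> g \<Longrightarrow> u \<in> Poly_Mapping.keys g \<Longrightarrow> \<not> mon_dvd (lead_mon r h) u"
    using G g(1) by (auto simp: reduced_groebner_basis_def groebner_basis_def)
  have gI: "g \<in> toric_ideal A" using GI g(1) by blast
  have mon: "pos_mon w \<in> monomials ?n" "pos_mon (- w) \<in> monomials ?n"
    using w by (auto intro: pos_mon_monomials)
  obtain v where v: "v \<in> Poly_Mapping.keys g" "v \<noteq> pos_mon w" "mon_deg A v = mon_deg A (pos_mon w)"
    using toric_ideal_key_partner[OF gI, of "pos_mon w"] g(2) by blast
  then have v': "v = pos_mon (- w)" using g(2) by blast
  have wk: "w \<in> mat_kernel A" using mat_kernel_iff_mon_deg[OF w] v(3) v' by simp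
  have g0: "g \<noteq> 0" using g(2) by auto
  \<comment> \<open>Otherwise the leading monomial of \<open>g\<close> would be 1, the least
    monomial of all, and the other term could not differ from it.\<close>
  have pos0: "pos_mon w \<noteq> 0"
  proof
    assume "pos_mon w = 0"
    then have "(v, 0) \<in> r"
      using lead_mon_max(2)[OF r g0 toric_ideal_fiber_sum(1)[OF gI] v(1)] g(3) by simp
    moreover have "(0, v) \<in> r" using term_orderD(6)[OF r] mon v' by blast
    ultimately show False using term_orderD(3)[OF r] v(2) \<open>pos_mon w = 0\<close> by metis
  qed
  have full: "pos_mon a = pos_mon w"
    if a: "a \<in> mat_kernel A" "conformal a w" "a \<noteq> 0\<^sub>v ?n" for a
  proof -
    let ?f = "xpow (pos_mon a) - xpow (pos_mon (- a)) :: 'k mpoly"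
    have ac: "a \<in> carrier_vec ?n" using a(1) by (simp add: mat_kernel_def)
    have amon: "pos_mon a \<in> monomials ?n" "pos_mon (- a) \<in> monomials ?n"
      using ac by (auto intro: pos_mon_monomials)
    have fI: "?f \<in> toric_ideal A"
      using amon mat_kernel_iff_mon_deg[OF ac] a(1) by (intro toric_binomial_mem) auto
    have "pos_mon a \<noteq> pos_mon (- a)" using pos_mon_eq_uminus[OF ac] a(3) by blast
    then have keys: "Poly_Mapping.keys ?f = {pos_mon a, pos_mon (- a)}" by (rule keys_binomial)
    then have f0: "?f \<noteq> 0" by auto
    have lf: "lead_mon r ?f = pos_mon a \<or> lead_mon r ?f = pos_mon (- a)"
      using lead_mon_max(1)[OF r f0 toric_ideal_fiber_sum(1)[OF fI]] unfolding keys by blast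
    obtain h where h: "h \<in> G" "mon_dvd (lead_mon r h) (lead_mon r ?f)"
      using reduced_basis_lead_dvd[OF r G fI f0] .
    have dw: "mon_dvd (pos_mon a) (pos_mon w)" "mon_dvd (pos_mon (- a)) (pos_mon (- w))"
      using a(2) by (auto intro: conformal_pos_mon simp: conformal_uminus)
    have "\<exists>u\<in>Poly_Mapping.keys g. mon_dvd (lead_mon r ?f) u" using lf dw g(2) by auto
    \<comment> \<open>The leading monomial of \<open>h\<close> divides that of the binomial of
      \<open>a\<close>, which divides a term of \<open>g\<close>; in a reduced basis only
      \<open>g\<close> itself can do that.\<close>
    then have "h = g" using red[OF h(1)] h(2) mon_dvd_trans by blast
    then have dvd: "mon_dvd (pos_mon w) (lead_mon r ?f)" using h(2) g(3) by simp
    from lf show ?thesis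
    proof
      assume "lead_mon r ?f = pos_mon a"
      then show ?thesis using dvd dw(1) mon_dvd_antisym by metis
    next
      assume "lead_mon r ?f = pos_mon (- a)"
      then have "mon_dvd (pos_mon w) (pos_mon (- w))" using dvd dw(2) mon_dvd_trans by metis
      then show ?thesis using pos_mon_disjoint pos0 by blast
    qed
  qed
  show ?thesis unfolding primitive_def
  proof (intro conjI ballI impI)
    show "w \<noteq> 0\<^sub>v ?n"
    proof
      assume "w = 0\<^sub>v ?n"
      then have "pos_mon w = 0" by (intro poly_mapping_eqI) (simp add: lookup_pos_mon)
      then show False using pos0 by blast
    qed
    fix a assume a: "a \<in> mat_kernel A" "conformal a w"
    show "a = 0\<^sub>v ?n \<or> a = w"
    proof (rule ccontr)
      assume n: "\<not> (a = 0\<^sub>v ?n \<or> a = w)"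
      have "a \<in> carrier_vec ?n" using a(1) by (simp add: mat_kernel_def)
      then have "w - a \<noteq> 0\<^sub>v ?n" using n w by (auto simp: vec_eq_iff)
      then have "pos_mon (w - a) = pos_mon w"
        by (intro full mat_kernel_minus wk a conformal_diff)
      moreover have "pos_mon a = pos_mon w" using full[OF a] n by blast
      ultimately have "pos_mon w + pos_mon w = pos_mon w"
        using conformal_pos_mon_add[OF a(2)] by simp
      then show False using pos0 by simp
    qed
  qed (rule wk)
qed

text \<open>Either part of the binomial may lead. If the negative one does, the argument applies to
  \<open>- w\<close>, and primitivity is symmetric in the sign.\<close>

theorem universal_groebner_basis_primitive:
  assumes "w \<in> universal_groebner_basis TYPE('k::field) A"
  shows "primitive A w"
proof -
  have *: "primitive A w" if w: "w \<in> carrier_vec (dim_col A)" and r: "term_order (dim_col A) r"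
    and G: "reduced_groebner_basis (dim_col A) r (toric_ideal A) (G :: 'k mpoly set)"
    and g: "vec_binomial w \<in> G" for w r G
  proof -
    let ?g = "vec_binomial w :: 'k mpoly"
    have gI: "?g \<in> toric_ideal A" and g0: "?g \<noteq> 0"
      using G g by (auto simp: reduced_groebner_basis_def groebner_basis_def)
    have "pos_mon w \<noteq> pos_mon (- w)" using g0 by (auto simp: vec_binomial_def)
    then have keys: "Poly_Mapping.keys ?g = {pos_mon w, pos_mon (- w)}"
      unfolding vec_binomial_def by (rule keys_binomial)
    have "lead_mon r ?g = pos_mon w \<or> lead_mon r ?g = pos_mon (- w)"
      using lead_mon_max(1)[OF r g0 toric_ideal_fiber_sum(1)[OF gI]] unfolding keys by blast
    then show ?thesis
    proof
      assume "lead_mon r ?g = pos_mon w"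
      then show ?thesis by (rule reduced_basis_element_primitive[OF r G g keys _ w])
    next
      assume "lead_mon r ?g = pos_mon (- w)"
      then have "primitive A (- w)"
        using keys w by (intro reduced_basis_element_primitive[OF r G g]) auto
      then show ?thesis using primitive_uminus[of A "- w"] by simp
    qed
  qed
  obtain r G where w: "w \<in> carrier_vec (dim_col A)" "term_order (dim_col A) r"
    "reduced_groebner_basis (dim_col A) r (toric_ideal A) (G :: 'k mpoly set)"
    "vec_binomial w \<in> G \<or> vec_binomial (- w) \<in> G"
    using assms by (auto simp: universal_groebner_basis_def Let_def)
  from w(4) show ?thesis
  proof
    assume "vec_binomial w \<in> G"
    then show ?thesis by (rule *[OF w(1-3)])
  next
    assume "vec_binomial (- w) \<in> G"
    then have "primitive A (- w)" by (intro *[OF _ w(2,3)]) (use w(1) in auto)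
    then show ?thesis using primitive_uminus[of A "- w"] by simp
  qed
qed

text \<open>Monomials are compared by their degree in the variables outside \<open>S\<close>, then
  by the exponent of \<open>k\<close>, and finally by the lexicographic order \<open>\<le>\<close>
  on exponent vectors, which makes the order total.\<close>

definition weight_order :: "nat \<Rightarrow> nat set \<Rightarrow> nat \<Rightarrow> mon rel" where
  "weight_order n S k = {(u, v). u \<in> monomials n \<and> v \<in> monomials n \<and>
     (let c = \<lambda>u. \<Sum>i\<in>{..<n} - S. Poly_Mapping.lookup u i in
      c u < c v \<or> c u = c v \<and>
        (Poly_Mapping.lookup u k < Poly_Mapping.lookup v k \<or>
         Poly_Mapping.lookup u k = Poly_Mapping.lookup v k \<and> u \<le> v))}"

text \<open>At the first index where \<open>u\<close> differs from zero, a lexicographically smaller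
  \<open>u\<close> would need an exponent below 0.\<close>

lemma zero_le_mon: "0 \<le> (u :: mon)"
proof (rule ccontr)
  assume "\<not> 0 \<le> u"
  then have "u < 0" by simp
  then show False by (auto simp: less_poly_mapping.rep_eq less_fun_def)
qed

lemma term_order_weight_order: "term_order n (weight_order n S k)"
  unfolding term_order_def linear_order_on_def partial_order_on_def preorder_on_def
proof (intro conjI)
  let ?c = "\<lambda>u. \<Sum>i\<in>{..<n} - S. Poly_Mapping.lookup u i"
  show "weight_order n S k \<subseteq> monomials n \<times> monomials n" by (auto simp: weight_order_def)
  show "refl_on (monomials n) (weight_order n S k)" by (auto simp: refl_on_def weight_order_def)
  show "trans (weight_order n S k)"
    by (rule transI) (auto simp: weight_order_def Let_def)
  show "antisym (weight_order n S k)"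
    by (rule antisymI) (auto simp: weight_order_def Let_def)
  show "total_on (monomials n) (weight_order n S k)"
    by (auto simp: total_on_def weight_order_def Let_def)
  show "\<forall>u\<in>monomials n. (0, u) \<in> weight_order n S k"
    by (auto simp: weight_order_def Let_def zero_le_mon)
  show "\<forall>u v. \<forall>w\<in>monomials n. (u, v) \<in> weight_order n S k \<longrightarrow> (u + w, v + w) \<in> weight_order n S k"
    by (auto simp: weight_order_def Let_def lookup_add sum.distrib monomials_add add_right_mono)
qed

text \<open>
  The weight order vanishes on the support of \<open>w\<close> and is positive elsewhere, so only the monomials
  of the fiber supported on \<open>S\<close> compete with \<open>w\<^sup>+\<close> and \<open>w\<^sup>-\<close>; the variable \<open>k\<close> breaks their tie.
\<close>

lemma universal_groebner_basisI:
  fixes A :: "int mat"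
  defines "n \<equiv> dim_col A"
  assumes w: "w \<in> mat_kernel A" and k: "k < n" "w $ k > 0"
    and fiber: "\<And>y. y \<in> monomials n \<Longrightarrow> mon_deg A y = mon_deg A (pos_mon w) \<Longrightarrow>
      (\<And>i. i < n \<Longrightarrow> w $ i = 0 \<Longrightarrow> Poly_Mapping.lookup y i = 0) \<Longrightarrow>
      y = pos_mon w \<or> y = pos_mon (- w)"
  shows "w \<in> universal_groebner_basis TYPE('k::field) A"
proof -
  define S where "S = {i. w $ i \<noteq> 0}"
  define r where "r = weight_order n S k"
  define c where "c u = (\<Sum>i\<in>{..<n} - S. Poly_Mapping.lookup u i)" for u :: mon
  have r: "term_order (dim_col A) r" unfolding r_def n_def by (rule term_order_weight_order)
  have rI: "(u, v) \<in> r \<longleftrightarrow> u \<in> monomials n \<and> v \<in> monomials n \<and> (c u < c v \<or> c u = c v \<and>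
        (Poly_Mapping.lookup u k < Poly_Mapping.lookup v k \<or>
         Poly_Mapping.lookup u k = Poly_Mapping.lookup v k \<and> u \<le> v))" for u v
    by (simp add: r_def weight_order_def c_def)
  have wc: "w \<in> carrier_vec n" using w by (simp add: mat_kernel_def n_def)
  have mon: "pos_mon w \<in> monomials n" "pos_mon (- w) \<in> monomials n"
    using wc by (auto intro: pos_mon_monomials)
  have deg: "mon_deg A (pos_mon (- w)) = mon_deg A (pos_mon w)"
    using mat_kernel_iff_mon_deg[of w A] w wc by (simp add: n_def)
  have c0: "c (pos_mon w) = 0" "c (pos_mon (- w)) = 0"
    using wc by (auto simp: c_def S_def lookup_pos_mon)
  have lk: "Poly_Mapping.lookup (pos_mon (- w)) k < Poly_Mapping.lookup (pos_mon w) k"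
    using k wc by (simp add: lookup_pos_mon)
  have less: "(pos_mon (- w), pos_mon w) \<in> r" using mon c0 lk by (simp add: rI)
  have c_zero: "Poly_Mapping.lookup u i = 0" if "c u = 0" "i < n" "w $ i = 0" for u i
    using that by (auto simp: c_def S_def)
  have fiber0: "y = pos_mon w \<or> y = pos_mon (- w)"
    if "y \<in> monomials n" "mon_deg A y = mon_deg A (pos_mon w)" "c y = 0" for y
    using fiber[OF that(1,2)] c_zero[OF that(3)] by blast
  have ne: "pos_mon (- w) \<noteq> pos_mon w" using lk by auto
  have nonstd: "pos_mon w \<in> nonstandard A r"
    using mon deg less ne by (auto simp: nonstandard_def n_def)
  \<comment> \<open>Minimality of x^(w+) among nonstandard monomials. A smaller companion
    \<open>y\<close> of a divisor \<open>v\<close>, multiplied by the cofactor of \<open>v\<close>,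
    lies in the fiber of x^(w+) and uses only variables of the support, so \<open>fiber0\<close>
    applies to the product.\<close>
  have "v = pos_mon w" if v: "v \<in> nonstandard A r" "mon_dvd v (pos_mon w)" for v
  proof (rule ccontr)
    assume vn: "v \<noteq> pos_mon w"
    let ?d = "pos_mon w - v"
    obtain y where y: "v \<in> monomials n" "y \<in> monomials n" "mon_deg A y = mon_deg A v" "y \<noteq> v" "(y, v) \<in> r"
      using v(1) by (auto simp: nonstandard_def n_def)
    have vd: "v + ?d = pos_mon w" using v(2) by (rule mon_dvd_add_diff)
    have c_add: "c (a + b) = c a + c b" for a b by (simp add: c_def lookup_add sum.distrib)
    have "c v + c ?d = 0" using vd c0 c_add by metis
    then have "c v = 0" "c ?d = 0" by auto
    \<comment> \<open>Since \<open>y\<close> is below \<open>v\<close> in the order and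
      \<open>v\<close> has weight 0, the weight of \<open>y\<close> is 0 too.\<close>
    then have "c (y + ?d) = 0" using y(5) by (simp add: rI c_add)
    moreover have "mon_deg A (y + ?d) = mon_deg A (pos_mon w)"
      using y(3) vd mon_deg_add by metis
    moreover have "y + ?d \<in> monomials n" using y(2) mon(1) by (intro monomials_add monomials_diff)
    ultimately have "y + ?d = pos_mon w \<or> y + ?d = pos_mon (- w)" using fiber0 by blast
    then show False
    proof
      assume "y + ?d = pos_mon w"
      then show False using vd y(4) by (metis add_right_cancel)
    next
      assume *: "y + ?d = pos_mon (- w)"
      \<comment> \<open>The cofactor divides both the positive and the negative monomial of
        \<open>w\<close>, whose supports are disjoint.\<close>
      have "?d = 0"
      proof (rule poly_mapping_eqI)
        fix i
        have "Poly_Mapping.lookup y i + Poly_Mapping.lookup ?d i = Poly_Mapping.lookup (pos_mon (- w)) i"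
          using arg_cong[OF *, of "\<lambda>p. Poly_Mapping.lookup p i"] by (simp add: lookup_add)
        moreover have "Poly_Mapping.lookup v i + Poly_Mapping.lookup ?d i = Poly_Mapping.lookup (pos_mon w) i"
          using arg_cong[OF vd, of "\<lambda>p. Poly_Mapping.lookup p i"] by (simp add: lookup_add)
        ultimately show "Poly_Mapping.lookup ?d i = Poly_Mapping.lookup 0 i"
          by (auto simp: lookup_pos_mon split: if_splits)
      qed
      then show False using vd vn by simp
    qed
  qed
  then have min: "pos_mon w \<in> minimal_mons (nonstandard A r)"
    using nonstd by (auto simp: minimal_mons_def)
  have "normal_form A r (pos_mon w) = pos_mon (- w)"
  proof (rule normal_form_eqI[OF r])
    fix y assume y: "y \<in> monomials (dim_col A)" "mon_deg A y = mon_deg A (pos_mon w)"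
    \<comment> \<open>A monomial of the fiber is one of the two parts of \<open>w\<close>, or it has
      positive weight and so lies above the negative part.\<close>
    show "(pos_mon (- w), y) \<in> r"
    proof (cases "c y = 0")
      case True
      then show ?thesis
        using fiber0[of y] y less term_orderD(1)[OF r, of y] by (auto simp: n_def)
    next
      case False
      then show ?thesis using y mon c0 by (simp add: rI n_def)
    qed
  qed (use mon deg in \<open>auto simp: n_def\<close>)
  then have "vec_binomial w \<in> (toric_reduced_basis A r :: 'k mpoly set)"
    unfolding toric_reduced_basis_def vec_binomial_def using min by (intro image_eqI) auto
  then show ?thesis
    using toric_reduced_basis_reduced[OF r] r wc
    unfolding universal_groebner_basis_def Let_def n_def by blast
qed

subsection \<open>Higher Lawrence liftings layer by layer\<close>

lemma layer_dim [simp]: "layer n x i \<in> carrier_vec n" "dim_vec (layer n x i) = n"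
  by (simp_all add: layer_def)

lemma layer_index: "j < n \<Longrightarrow> layer n x i $ j = x $ (i * n + j)"
  by (simp add: layer_def)

lemma layer_position_less: "i < N \<Longrightarrow> j < n \<Longrightarrow> i * n + j < N * (n::nat)"
proof -
  assume "i < N" "j < n"
  then have "i * n + j < (i + 1) * n" by simp
  also have "\<dots> \<le> N * n" using \<open>i < N\<close> by (intro mult_le_mono1) simp
  finally show ?thesis .
qed

lemma layer_position_cases:
  assumes "k < N * (n::nat)"
  obtains i j where "i < N" "j < n" "k = i * n + j"
proof
  have "n > 0" using assms by (cases n) auto
  then show "k div n < N" "k mod n < n" "k = k div n * n + k mod n"
    using assms by (auto simp: less_mult_imp_div_less)
qed

lemma layers_eqI:
  assumes "x \<in> carrier_vec (N * n)" "y \<in> carrier_vec (N * n)"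
    and "\<And>i. i < N \<Longrightarrow> layer n x i = layer n y i"
  shows "x = y"
proof (rule eq_vecI)
  fix k assume "k < dim_vec y"
  then have "k < N * n" using assms(2) by simp
  then obtain i j where "i < N" "j < n" "k = i * n + j" by (rule layer_position_cases)
  then show "x $ k = y $ k" using arg_cong[OF assms(3), of i "\<lambda>v. v $ j"] by (simp add: layer_index)
qed (use assms in simp)

lemma layer_zero: "i < N \<Longrightarrow> layer n (0\<^sub>v (N * n)) i = 0\<^sub>v n"
  using layer_position_less by (auto simp: layer_def)

lemma conformal_layers:
  assumes "x \<in> carrier_vec (N * n)" "y \<in> carrier_vec (N * n)"
  shows "conformal x y \<longleftrightarrow> (\<forall>i<N. conformal (layer n x i) (layer n y i))"
proof
  assume "conformal x y"
  then show "\<forall>i<N. conformal (layer n x i) (layer n y i)"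
    using assms layer_position_less by (auto simp: conformal_def layer_index)
next
  assume R: "\<forall>i<N. conformal (layer n x i) (layer n y i)"
  show "conformal x y" unfolding conformal_def
  proof (intro conjI allI impI)
    fix k assume "k < dim_vec y"
    then have "k < N * n" using assms by simp
    then obtain i j where "i < N" "j < n" "k = i * n + j" by (rule layer_position_cases)
    then show "0 \<le> x $ k \<and> x $ k \<le> y $ k \<or> y $ k \<le> x $ k \<and> x $ k \<le> 0"
      using R by (auto simp: conformal_def layer_index)
  qed (use assms in simp)
qed

lemma sum_layers: "(\<Sum>k<N * n. f k) = (\<Sum>i<N. \<Sum>j<n. f (i * n + j))"
  for f :: "nat \<Rightarrow> 'b::comm_monoid_add"
proof -
  have "sum f {i * n..<i * n + n} = (\<Sum>j<n. f (i * n + j))" for i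
    using sum.shift_bounds_nat_ivl[of f 0 "i * n" n] by (simp add: atLeast0LessThan add.commute)
  then show ?thesis by (simp add: sum.nat_group[of f n N, symmetric])
qed

lemma dim_replicate_block:
  "dim_row (diag_block_mat (replicate N A)) = N * dim_row A"
  "dim_col (diag_block_mat (replicate N A)) = N * dim_col A"
  by (simp_all add: dim_diag_block_mat sum_list_replicate)

text \<open>Induction peels off the first block: its layer is the head \<open>a\<close>, and the
  layers of the tail \<open>d\<close> are those of \<open>x\<close> shifted by one.\<close>

lemma diag_block_kernel:
  fixes A :: "int mat"
  assumes "x \<in> carrier_vec (N * dim_col A)"
  shows "diag_block_mat (replicate N A) *\<^sub>v x = 0\<^sub>v (N * dim_row A) \<longleftrightarrow>
     (\<forall>i<N. A *\<^sub>v layer (dim_col A) x i = 0\<^sub>v (dim_row A))"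
  using assms
proof (induction N arbitrary: x)
  case 0
  then show ?case by (auto intro!: eq_vecI)
next
  case (Suc N)
  let ?n = "dim_col A" and ?m = "dim_row A"
  let ?D = "diag_block_mat (replicate N A)"
  have D: "?D \<in> carrier_mat (N * ?m) (N * ?n)" using dim_replicate_block by blast
  define a where "a = vec_first x ?n"
  define d where "d = vec_last x (N * ?n)"
  have x: "x = a @\<^sub>v d" using Suc.prems by (simp add: a_def d_def)
  have a: "a \<in> carrier_vec ?n" and d: "d \<in> carrier_vec (N * ?n)" by (simp_all add: a_def d_def)
  have "diag_block_mat (replicate (Suc N) A) *\<^sub>v x
      = four_block_mat A (0\<^sub>m ?m (N * ?n)) (0\<^sub>m (N * ?m) ?n) ?D *\<^sub>v (a @\<^sub>v d)"
    unfolding x by (simp add: Let_def dim_replicate_block)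
  also have "\<dots> = (A *\<^sub>v a + 0\<^sub>m ?m (N * ?n) *\<^sub>v d) @\<^sub>v (0\<^sub>m (N * ?m) ?n *\<^sub>v a + ?D *\<^sub>v d)"
    by (rule four_block_mat_mult_vec) (use a d D in auto)
  also have "\<dots> = (A *\<^sub>v a) @\<^sub>v (?D *\<^sub>v d)"
    using a d D by (auto intro!: arg_cong2[where f = append_vec] eq_vecI)
  finally have eq: "diag_block_mat (replicate (Suc N) A) *\<^sub>v x = (A *\<^sub>v a) @\<^sub>v (?D *\<^sub>v d)" .
  have zero: "0\<^sub>v (Suc N * ?m) = (0\<^sub>v ?m @\<^sub>v 0\<^sub>v (N * ?m) :: int vec)"
    by (auto intro!: eq_vecI)
  have "(A *\<^sub>v a) @\<^sub>v (?D *\<^sub>v d) = 0\<^sub>v ?m @\<^sub>v 0\<^sub>v (N * ?m)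
      \<longleftrightarrow> A *\<^sub>v a = 0\<^sub>v ?m \<and> ?D *\<^sub>v d = 0\<^sub>v (N * ?m)"
    by (rule append_vec_eq[of _ ?m]) (auto intro: carrier_vecI)
  moreover have "layer ?n x 0 = a"
    unfolding x using a by (intro eq_vecI) (auto simp: layer_index)
  moreover have "layer ?n x (Suc i) = layer ?n d i" if "i < N" for i
    unfolding x using a d layer_position_less[OF that, of _ ?n] by (intro eq_vecI) (auto simp: layer_index)
  ultimately show ?case
    unfolding eq zero using Suc.IH[OF d] by (simp add: All_less_Suc2)
qed

lemma dim_lawrence_lifting [simp]:
  "dim_col (lawrence_lifting A N) = N * dim_col A"
  "dim_row (lawrence_lifting A N) = dim_col A + N * dim_row A"
  by (simp_all add: lawrence_lifting_def Let_def append_rows_def dim_replicate_block)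

text \<open>The kernel of the lifting as families of kernel vectors of \<open>A\<close> with sum
  zero. Families are functions, so that a layer can be replaced or appended by function update;
  values from \<open>N\<close> on carry no meaning.\<close>

definition layers_kernel :: "int mat \<Rightarrow> nat \<Rightarrow> (nat \<Rightarrow> int vec) \<Rightarrow> bool" where
  "layers_kernel A N f \<longleftrightarrow>
     (\<forall>i<N. f i \<in> mat_kernel A) \<and> (\<forall>j<dim_col A. (\<Sum>i<N. f i $ j) = 0)"

lemma lawrence_kernel_iff:
  assumes x: "x \<in> carrier_vec (N * dim_col A)"
  shows "x \<in> mat_kernel (lawrence_lifting A N) \<longleftrightarrow> layers_kernel A N (layer (dim_col A) x)"
proof -
  let ?n = "dim_col A" and ?m = "dim_row A"
  let ?D = "diag_block_mat (replicate N A)"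
  let ?I = "mat ?n (N * ?n) (\<lambda>(i, j). if j mod ?n = i then 1 else 0) :: int mat"
  have I: "?I *\<^sub>v x = vec ?n (\<lambda>j. \<Sum>i<N. layer ?n x i $ j)"
  proof (rule eq_vecI)
    fix j assume "j < dim_vec (vec ?n (\<lambda>j. \<Sum>i<N. layer ?n x i $ j))"
    then have j: "j < ?n" by simp
    have "(?I *\<^sub>v x) $ j = (\<Sum>k<N * ?n. (if k mod ?n = j then 1 else 0) * x $ k)"
      using j x by (simp add: scalar_prod_def atLeast0LessThan)
    also have "\<dots> = (\<Sum>i<N. \<Sum>l<?n. if l = j then x $ (i * ?n + l) else 0)"
      unfolding sum_layers by (intro sum.cong refl) auto
    also have "\<dots> = (\<Sum>i<N. layer ?n x i $ j)" using j by (simp add: layer_index)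
    finally show "(?I *\<^sub>v x) $ j = vec ?n (\<lambda>j. \<Sum>i<N. layer ?n x i $ j) $ j" using j by simp
  qed simp
  have "lawrence_lifting A N *\<^sub>v x = (?I *\<^sub>v x) @\<^sub>v (?D *\<^sub>v x)"
    unfolding lawrence_lifting_def Let_def
    by (rule mat_mult_append[OF _ _ x]) (auto simp: dim_replicate_block)
  moreover have "0\<^sub>v (?n + N * ?m) = (0\<^sub>v ?n @\<^sub>v 0\<^sub>v (N * ?m) :: int vec)"
    by (auto intro!: eq_vecI)
  moreover have "(?I *\<^sub>v x) @\<^sub>v (?D *\<^sub>v x) = 0\<^sub>v ?n @\<^sub>v 0\<^sub>v (N * ?m)
      \<longleftrightarrow> ?I *\<^sub>v x = 0\<^sub>v ?n \<and> ?D *\<^sub>v x = 0\<^sub>v (N * ?m)"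
    by (rule append_vec_eq[of _ ?n]) (auto intro: carrier_vecI)
  ultimately have "lawrence_lifting A N *\<^sub>v x = 0\<^sub>v (?n + N * ?m)
      \<longleftrightarrow> ?I *\<^sub>v x = 0\<^sub>v ?n \<and> ?D *\<^sub>v x = 0\<^sub>v (N * ?m)" by simp
  moreover have "?I *\<^sub>v x = 0\<^sub>v ?n \<longleftrightarrow> (\<forall>j<?n. (\<Sum>i<N. layer ?n x i $ j) = 0)"
    unfolding I by (auto simp: vec_eq_iff)
  ultimately show ?thesis
    using x diag_block_kernel[OF x] by (auto simp: mat_kernel_def layers_kernel_def)
qed

definition primitive_layers :: "int mat \<Rightarrow> nat \<Rightarrow> (nat \<Rightarrow> int vec) \<Rightarrow> bool" where
  "primitive_layers A N f \<longleftrightarrow> layers_kernel A N f \<and> (\<exists>i<N. f i \<noteq> 0\<^sub>v (dim_col A)) \<and>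
     (\<forall>g. layers_kernel A N g \<longrightarrow> (\<forall>i<N. conformal (g i) (f i)) \<longrightarrow>
        (\<forall>i<N. g i = 0\<^sub>v (dim_col A)) \<or> (\<forall>i<N. g i = f i))"

definition of_layers :: "nat \<Rightarrow> nat \<Rightarrow> (nat \<Rightarrow> int vec) \<Rightarrow> int vec" where
  "of_layers n N f = vec (N * n) (\<lambda>k. f (k div n) $ (k mod n))"

lemma of_layers_carrier [simp]: "of_layers n N f \<in> carrier_vec (N * n)"
  by (simp add: of_layers_def)

lemma layer_of_layers:
  "i < N \<Longrightarrow> f i \<in> carrier_vec n \<Longrightarrow> layer n (of_layers n N f) i = f i"
  using layer_position_less by (auto simp: of_layers_def layer_def)

lemma layers_kernel_cong:
  "(\<And>i. i < N \<Longrightarrow> f i = g i) \<Longrightarrow> layers_kernel A N f \<longleftrightarrow> layers_kernel A N g"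
  by (simp add: layers_kernel_def)

lemma primitive_layers_cong:
  "(\<And>i. i < N \<Longrightarrow> f i = g i) \<Longrightarrow> primitive_layers A N f \<longleftrightarrow> primitive_layers A N g"
proof -
  assume fg: "\<And>i. i < N \<Longrightarrow> f i = g i"
  then have "(\<exists>i<N. f i \<noteq> 0\<^sub>v (dim_col A)) \<longleftrightarrow> (\<exists>i<N. g i \<noteq> 0\<^sub>v (dim_col A))" by auto
  then show ?thesis
    unfolding primitive_layers_def using fg layers_kernel_cong[of N f g A] by simp
qed

lemma layers_kernel_carrier: "layers_kernel A N f \<Longrightarrow> i < N \<Longrightarrow> f i \<in> carrier_vec (dim_col A)"
  by (simp add: layers_kernel_def mat_kernel_def)

lemma primitive_lawrence_iff:
  assumes x: "x \<in> carrier_vec (N * dim_col A)"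
  shows "primitive (lawrence_lifting A N) x \<longleftrightarrow> primitive_layers A N (layer (dim_col A) x)"
proof -
  let ?n = "dim_col A" and ?L = "lawrence_lifting A N"
  have zero: "y = 0\<^sub>v (N * ?n) \<longleftrightarrow> (\<forall>i<N. layer ?n y i = 0\<^sub>v ?n)" if "y \<in> carrier_vec (N * ?n)" for y
    using layers_eqI[OF that, of "0\<^sub>v (N * ?n)"] layer_zero by auto
  have eq: "y = x \<longleftrightarrow> (\<forall>i<N. layer ?n y i = layer ?n x i)" if "y \<in> carrier_vec (N * ?n)" for y
    using layers_eqI[OF that x] by auto
  have kc: "y \<in> carrier_vec (N * ?n)" if "y \<in> mat_kernel ?L" for y
    using that by (simp add: mat_kernel_def)
  show ?thesis
  proof
    assume p: "primitive ?L x"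
    show "primitive_layers A N (layer ?n x)"
      unfolding primitive_layers_def
    proof (intro conjI allI impI)
      show "layers_kernel A N (layer ?n x)"
        using p lawrence_kernel_iff[OF x] by (simp add: primitive_def)
      show "\<exists>i<N. layer ?n x i \<noteq> 0\<^sub>v ?n" using p zero[OF x] by (simp add: primitive_def)
      fix g assume g: "layers_kernel A N g" "\<forall>i<N. conformal (g i) (layer ?n x i)"
      let ?y = "of_layers ?n N g"
      have ly: "layer ?n ?y i = g i" if "i < N" for i
        using layer_of_layers[OF that] layers_kernel_carrier[OF g(1) that] by blast
      have "?y \<in> mat_kernel ?L"
        using lawrence_kernel_iff[of ?y N A] g(1) layers_kernel_cong[of N "layer ?n ?y" g A] ly by simp
      moreover have "conformal ?y x" using conformal_layers[OF of_layers_carrier x] g(2) ly by simp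
      ultimately have "?y = 0\<^sub>v (N * ?n) \<or> ?y = x" using p by (simp add: primitive_def)
      then show "(\<forall>i<N. g i = 0\<^sub>v ?n) \<or> (\<forall>i<N. g i = layer ?n x i)"
        using zero[of ?y] eq[of ?y] ly by simp
    qed
  next
    assume p: "primitive_layers A N (layer ?n x)"
    show "primitive ?L x"
      unfolding primitive_def
    proof (intro conjI ballI impI)
      show "x \<in> mat_kernel ?L" using p lawrence_kernel_iff[OF x] by (simp add: primitive_layers_def)
      show "x \<noteq> 0\<^sub>v (dim_col ?L)" using p zero[OF x] by (auto simp: primitive_layers_def)
      fix y assume y: "y \<in> mat_kernel ?L" "conformal y x"
      have "(\<forall>i<N. layer ?n y i = 0\<^sub>v ?n) \<or> (\<forall>i<N. layer ?n y i = layer ?n x i)"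
        using p y lawrence_kernel_iff[OF kc[OF y(1)]] conformal_layers[OF kc[OF y(1)] x]
        by (simp add: primitive_layers_def)
      then show "y = 0\<^sub>v (dim_col ?L) \<or> y = x" using zero[OF kc[OF y(1)]] eq[OF kc[OF y(1)]] by simp
    qed
  qed
qed

lemma primitive_of_layers:
  assumes "primitive_layers A N f"
  shows "primitive (lawrence_lifting A N) (of_layers (dim_col A) N f)"
    and "i < N \<Longrightarrow> layer (dim_col A) (of_layers (dim_col A) N f) i = f i"
proof -
  have l: "layer (dim_col A) (of_layers (dim_col A) N f) i = f i" if "i < N" for i
    using assms layers_kernel_carrier[of A N f i] that
    by (intro layer_of_layers) (auto simp: primitive_layers_def)
  then show "primitive (lawrence_lifting A N) (of_layers (dim_col A) N f)"
    using primitive_lawrence_iff[OF of_layers_carrier] assms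
      primitive_layers_cong[of N "layer (dim_col A) (of_layers (dim_col A) N f)" f A] by simp
  show "i < N \<Longrightarrow> layer (dim_col A) (of_layers (dim_col A) N f) i = f i" by (rule l)
qed

text \<open>A circuit with coprime entries, stated over the integers: every integer kernel vector on
  its support is an integer multiple. The entries of both signs serve to bound that multiplier from
  both sides.\<close>

definition elementary :: "int mat \<Rightarrow> int vec \<Rightarrow> bool" where
  "elementary A v \<longleftrightarrow> v \<in> mat_kernel A \<and> (\<exists>i<dim_col A. v $ i > 0) \<and> (\<exists>i<dim_col A. v $ i < 0) \<and>
     (\<forall>d\<in>mat_kernel A. (\<forall>i<dim_col A. v $ i = 0 \<longrightarrow> d $ i = 0) \<longrightarrow>
        (\<exists>c. \<forall>i<dim_col A. d $ i = c * v $ i))"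

text \<open>At a positive entry the multiple \<open>c * v $ i\<close> lies between 0 and
  \<open>v $ i\<close>, which leaves only the factors 0 and 1.\<close>

lemma elementary_conformal:
  assumes v: "elementary A v" and d: "d \<in> mat_kernel A" "conformal d v"
  shows "d = 0\<^sub>v (dim_col A) \<or> d = v"
proof -
  have vk: "dim_vec v = dim_col A" "dim_vec d = dim_col A"
    using v d by (auto simp: elementary_def mat_kernel_def)
  have "\<forall>i<dim_col A. v $ i = 0 \<longrightarrow> d $ i = 0" using d(2) vk by (auto simp: conformal_def)
  then obtain c where c: "\<forall>i<dim_col A. d $ i = c * v $ i"
    using v d(1) unfolding elementary_def by blast
  obtain i where i: "i < dim_col A" "v $ i > 0" using v by (auto simp: elementary_def)
  have "0 \<le> c * v $ i \<and> c * v $ i \<le> v $ i" using c d(2) i vk by (fastforce simp: conformal_def)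
  then have "c = 0 \<or> c = 1" using i(2) by (auto simp: zero_le_mult_iff mult_le_cancel_right1)
  then show ?thesis using c vk by (auto simp: vec_eq_iff)
qed

lemma conformal_zero: "conformal (0\<^sub>v (dim_vec w)) w"
  by (auto simp: conformal_def)

text \<open>Let \<open>y\<close> be a point of the fiber of \<open>x\<close>'s positive part on the
  support of \<open>x\<close>. The difference to that part is a multiple of \<open>x\<close> on each
  layer, and nonnegativity of \<open>y\<close> forces each factor to be 0 or 1. So the difference is
  conformal to \<open>x\<close>, and primitivity makes it 0 or \<open>x\<close>.\<close>

lemma elementary_universal_groebner:
  assumes p: "primitive (lawrence_lifting A N) x"
    and el: "\<And>i. i < N \<Longrightarrow> layer (dim_col A) x i = 0\<^sub>v (dim_col A) \<or> elementary A (layer (dim_col A) x i)"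
  shows "x \<in> universal_groebner_basis TYPE('k::field) (lawrence_lifting A N)"
proof -
  let ?n = "dim_col A" and ?L = "lawrence_lifting A N"
  have xk: "x \<in> mat_kernel ?L" using p by (simp add: primitive_def)
  then have x: "x \<in> carrier_vec (N * ?n)" by (simp add: mat_kernel_def)
  have pl: "primitive_layers A N (layer ?n x)" using p primitive_lawrence_iff[OF x] by simp
  then obtain i0 where i0: "i0 < N" "layer ?n x i0 \<noteq> 0\<^sub>v ?n" by (auto simp: primitive_layers_def)
  then obtain j0 where j0: "j0 < ?n" "layer ?n x i0 $ j0 > 0"
    using el[OF i0(1)] by (auto simp: elementary_def)
  show ?thesis
  proof (rule universal_groebner_basisI[OF xk, of "i0 * ?n + j0"])
    show "i0 * ?n + j0 < dim_col ?L" using layer_position_less i0 j0 by simp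
    show "x $ (i0 * ?n + j0) > 0" using j0 by (simp add: layer_index)
    fix y
    assume y: "y \<in> monomials (dim_col ?L)" "mon_deg ?L y = mon_deg ?L (pos_mon x)"
      and supp: "\<And>i. i < dim_col ?L \<Longrightarrow> x $ i = 0 \<Longrightarrow> Poly_Mapping.lookup y i = 0"
    define d where "d = vec_of_mon (N * ?n) (pos_mon x) - vec_of_mon (N * ?n) y"
    have dc: "d \<in> carrier_vec (N * ?n)" by (simp add: d_def)
    have d_index: "d $ k = int (nat (x $ k)) - int (Poly_Mapping.lookup y k)" if "k < N * ?n" for k
      using that x by (simp add: d_def vec_of_mon_def lookup_pos_mon)
    have "?L *\<^sub>v d = mon_deg ?L (pos_mon x) - mon_deg ?L y"
      unfolding d_def mon_deg_def dim_lawrence_lifting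
      by (intro mult_minus_distrib_mat_vec[of _ "dim_row ?L" "dim_col ?L"]) auto
    moreover have "\<dots> = 0\<^sub>v (dim_row ?L)"
      using y(2) minus_eq_zero_vec_iff[OF mon_deg_carrier mon_deg_carrier] by metis
    ultimately have dk: "d \<in> mat_kernel ?L" using dc by (simp add: mat_kernel_def)
    then have lk: "layers_kernel A N (layer ?n d)" using lawrence_kernel_iff[OF dc] by simp
    have "layer ?n d i = 0\<^sub>v ?n \<or> layer ?n d i = layer ?n x i" if i: "i < N" for i
    proof -
      have d0: "layer ?n d i $ j = 0" if "j < ?n" "layer ?n x i $ j = 0" for j
        using d_index[OF layer_position_less[OF i that(1)]] that
          supp[of "i * ?n + j"] layer_position_less[OF i that(1)] by (simp add: layer_index)
      consider "layer ?n x i = 0\<^sub>v ?n" | "elementary A (layer ?n x i)" using el[OF i] by blast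
      then show ?thesis
      proof cases
        case 1
        then show ?thesis using d0 by (auto intro!: eq_vecI)
      next
        case 2
        have "layer ?n d i \<in> mat_kernel A" using lk i by (simp add: layers_kernel_def)
        then obtain c where c: "\<forall>j<?n. layer ?n d i $ j = c * layer ?n x i $ j"
          using 2 d0 unfolding elementary_def by blast
        have cx: "c * x $ k = int (nat (x $ k)) - int (Poly_Mapping.lookup y k)"
          if "k = i * ?n + j" "j < ?n" for k j
          using c that d_index[OF layer_position_less[OF i that(2)]] by (simp add: layer_index)
        obtain a where a: "a < ?n" "layer ?n x i $ a > 0" using 2 by (auto simp: elementary_def)
        obtain b where b: "b < ?n" "layer ?n x i $ b < 0" using 2 by (auto simp: elementary_def)
        \<comment> \<open>At a positive entry of \<open>x\<close> the difference is that entry minus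
          an exponent of \<open>y\<close>.\<close>
        have "c * x $ (i * ?n + a) \<le> 1 * x $ (i * ?n + a)"
          using cx[OF refl a(1)] a by (simp add: layer_index)
        then have "c \<le> 1" using a by (simp add: layer_index mult_le_cancel_right)
        \<comment> \<open>At a negative entry of \<open>x\<close> the positive part is 0, so the
          difference is minus an exponent of \<open>y\<close>.\<close>
        have "c * x $ (i * ?n + b) \<le> 0"
          using cx[OF refl b(1)] b by (simp add: layer_index)
        then have "c \<ge> 0" using b by (simp add: layer_index mult_le_0_iff)
        have "c = 0 \<or> c = 1" using \<open>c \<ge> 0\<close> \<open>c \<le> 1\<close> by linarith
        then show ?thesis using c by (auto intro!: eq_vecI)
      qed
    qed
    then have "conformal (layer ?n d i) (layer ?n x i)" if "i < N" for i
      using conformal_zero[of "layer ?n x i"] conformal_refl[of "layer ?n x i"] that by force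
    then have "d = 0\<^sub>v (N * ?n) \<or> d = x"
      using p dk conformal_layers[OF dc x] by (simp add: primitive_def)
    then show "y = pos_mon x \<or> y = pos_mon (- x)"
    proof
      assume d0: "d = 0\<^sub>v (N * ?n)"
      have "Poly_Mapping.lookup y k = Poly_Mapping.lookup (pos_mon x) k" for k
        using d_index[of k] d0 x y(1) by (cases "k < N * ?n") (auto simp: lookup_pos_mon monomials_iff split: if_splits)
      then show ?thesis by (simp add: poly_mapping_eqI)
    next
      assume dx: "d = x"
      have "Poly_Mapping.lookup y k = Poly_Mapping.lookup (pos_mon (- x)) k" for k
        using d_index[of k] dx x y(1) by (cases "k < N * ?n") (auto simp: lookup_pos_mon monomials_iff split: if_splits)
      then show ?thesis by (simp add: poly_mapping_eqI)
    qed
  qed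
qed

section \<open>Splitting layers of primitive vectors\<close>

lemma sum_merge_layers:
  assumes "i0 < N"
  shows "(\<Sum>i<Suc N. f i) = (\<Sum>i<N. if i = i0 then f i0 + f N else (f i :: int))"
proof -
  have "(\<Sum>i<N. if i = i0 then f i0 + f N else f i) = (\<Sum>i<N. f i + (if i = i0 then f N else 0))"
    by (intro sum.cong) auto
  then show ?thesis using assms by (simp add: sum.distrib)
qed

lemma conformal_add:
  assumes "conformal a w" "conformal g a" "conformal h (w - a)"
  shows "conformal (g + h) w"
proof -
  have "0 \<le> (g + h) $ i \<and> (g + h) $ i \<le> w $ i \<or> w $ i \<le> (g + h) $ i \<and> (g + h) $ i \<le> 0"
    if i: "i < dim_vec w" for i
  proof -
    have "0 \<le> a $ i \<and> a $ i \<le> w $ i \<or> w $ i \<le> a $ i \<and> a $ i \<le> 0"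
      "0 \<le> g $ i \<and> g $ i \<le> a $ i \<or> a $ i \<le> g $ i \<and> g $ i \<le> 0"
      "0 \<le> h $ i \<and> h $ i \<le> w $ i - a $ i \<or> w $ i - a $ i \<le> h $ i \<and> h $ i \<le> 0"
      "(g + h) $ i = g $ i + h $ i"
      using assms i unfolding conformal_def by auto
    then show ?thesis by linarith
  qed
  then show ?thesis using assms by (simp add: conformal_def)
qed

text \<open>In every coordinate \<open>g\<close> and \<open>h\<close> have the sign of
  \<open>w\<close> and are bounded by \<open>a\<close> and \<open>w - a\<close>. Their sum reaches
  an end of its range only if both summands do.\<close>

lemma conformal_add_eq:
  assumes "conformal a w" "conformal g a" "conformal h (w - a)" and w: "w \<in> carrier_vec n"
  shows "g + h = 0\<^sub>v n \<Longrightarrow> g = 0\<^sub>v n \<and> h = 0\<^sub>v n" and "g + h = w \<Longrightarrow> g = a \<and> h = w - a"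
proof -
  have dims: "dim_vec a = n" "dim_vec g = n" "dim_vec h = n" "dim_vec w = n"
    using assms by (auto simp: conformal_def)
  have *: "0 \<le> a $ i \<and> a $ i \<le> w $ i \<or> w $ i \<le> a $ i \<and> a $ i \<le> 0"
      "0 \<le> g $ i \<and> g $ i \<le> a $ i \<or> a $ i \<le> g $ i \<and> g $ i \<le> 0"
      "0 \<le> h $ i \<and> h $ i \<le> w $ i - a $ i \<or> w $ i - a $ i \<le> h $ i \<and> h $ i \<le> 0"
    if "i < n" for i
    using assms that dims unfolding conformal_def by auto
  {
    assume eq: "g + h = 0\<^sub>v n"
    have "g $ i = 0 \<and> h $ i = 0" if i: "i < n" for i
    proof -
      have "g $ i + h $ i = 0" using arg_cong[OF eq, of "\<lambda>v. v $ i"] i dims by simp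
      then show ?thesis using *[OF i] by linarith
    qed
    then show "g = 0\<^sub>v n \<and> h = 0\<^sub>v n" using dims by (auto intro!: eq_vecI)
  }
  {
    assume eq: "g + h = w"
    have "g $ i = a $ i \<and> h $ i = w $ i - a $ i" if i: "i < n" for i
    proof -
      have "g $ i + h $ i = w $ i" using arg_cong[OF eq, of "\<lambda>v. v $ i"] i dims by simp
      then show ?thesis using *[OF i] by linarith
    qed
    then show "g = a \<and> h = w - a" using dims by (auto intro!: eq_vecI)
  }
qed

text \<open>A family conformal to the split one becomes conformal to \<open>f\<close> after layers
  \<open>i0\<close> and \<open>N\<close> are added together. Primitivity of \<open>f\<close> makes
  the merged family 0 or \<open>f\<close>, and \<open>conformal_add_eq\<close> recovers the two
  separate layers.\<close>

lemma primitive_layers_split: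
  assumes p: "primitive_layers A N f" and i0: "i0 < N"
    and a: "a \<in> mat_kernel A" "conformal a (f i0)"
  shows "primitive_layers A (Suc N) (f(i0 := a, N := f i0 - a))"
proof -
  let ?n = "dim_col A"
  let ?f = "f(i0 := a, N := f i0 - a)"
  have fk: "\<And>i. i < N \<Longrightarrow> f i \<in> mat_kernel A" and fs: "\<And>j. j < ?n \<Longrightarrow> (\<Sum>i<N. f i $ j) = 0"
    and nz: "\<exists>i<N. f i \<noteq> 0\<^sub>v ?n"
    and prim: "\<And>g. layers_kernel A N g \<Longrightarrow> (\<forall>i<N. conformal (g i) (f i)) \<Longrightarrow>
        (\<forall>i<N. g i = 0\<^sub>v ?n) \<or> (\<forall>i<N. g i = f i)"
    using p unfolding primitive_layers_def layers_kernel_def by blast+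
  have dims: "dim_vec a = ?n" "\<And>i. i < N \<Longrightarrow> dim_vec (f i) = ?n"
    using mat_kernel_dim a fk by blast+
  have car: "f i0 \<in> carrier_vec ?n" using dims(2)[OF i0] by (rule carrier_vecI)
  have fN: "?f N = f i0 - a" "?f i0 = a" using i0 by auto
  show ?thesis unfolding primitive_layers_def
  proof (intro conjI allI impI)
    show "layers_kernel A (Suc N) ?f" unfolding layers_kernel_def
    proof (intro conjI allI impI)
      show "?f i \<in> mat_kernel A" if "i < Suc N" for i
        using that fk i0 a(1) mat_kernel_minus[OF fk[OF i0] a(1)] by auto
      show "(\<Sum>i<Suc N. ?f i $ j) = 0" if j: "j < ?n" for j
      proof -
        have "(\<Sum>i<Suc N. ?f i $ j) = (\<Sum>i<N. if i = i0 then ?f i0 $ j + ?f N $ j else ?f i $ j)"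
          by (rule sum_merge_layers[OF i0])
        also have "\<dots> = (\<Sum>i<N. f i $ j)"
          unfolding fN using j dims i0 by (intro sum.cong) auto
        finally show ?thesis using fs[OF j] by simp
      qed
    qed
    show "\<exists>i<Suc N. ?f i \<noteq> 0\<^sub>v ?n"
    proof (rule ccontr)
      assume *: "\<not> (\<exists>i<Suc N. ?f i \<noteq> 0\<^sub>v ?n)"
      then have "?f i0 = 0\<^sub>v ?n" "?f N = 0\<^sub>v ?n" using i0 by (blast intro: less_SucI)+
      then have "a = 0\<^sub>v ?n" "f i0 - a = 0\<^sub>v ?n" unfolding fN .
      then have "f i0 = 0\<^sub>v ?n" using minus_eq_zero_vec_iff[OF car, of a] by simp
      moreover have "f i = 0\<^sub>v ?n" if "i < N" "i \<noteq> i0" for i using * that 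
      proof -
        have "?f i = 0\<^sub>v ?n" using * that by (blast intro: less_SucI)
        then show ?thesis using that by simp
      qed
      ultimately show False using nz by blast
    qed
    fix g assume g: "layers_kernel A (Suc N) g" "\<forall>i<Suc N. conformal (g i) (?f i)"
    have gk: "g i \<in> mat_kernel A" if "i < Suc N" for i using g(1) that by (simp add: layers_kernel_def)
    have gi0: "conformal (g i0) a" using g(2)[rule_format, of i0] i0 unfolding fN by simp
    have gN: "conformal (g N) (f i0 - a)" using g(2)[rule_format, of N] unfolding fN by simp
    let ?h = "g(i0 := g i0 + g N)"
    have "layers_kernel A N ?h" unfolding layers_kernel_def
    proof (intro conjI allI impI)
      show "?h i \<in> mat_kernel A" if "i < N" for i using that gk i0 mat_kernel_add by auto
      show "(\<Sum>i<N. ?h i $ j) = 0" if j: "j < ?n" for j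
      proof -
        have "(\<Sum>i<Suc N. g i $ j) = (\<Sum>i<N. if i = i0 then g i0 $ j + g N $ j else g i $ j)"
          by (rule sum_merge_layers[OF i0])
        also have "\<dots> = (\<Sum>i<N. ?h i $ j)"
          using j mat_kernel_dim[OF gk[of N]] by (intro sum.cong) auto
        finally show ?thesis using g(1) j by (simp add: layers_kernel_def)
      qed
    qed
    moreover have "conformal (?h i) (f i)" if "i < N" for i
    proof (cases "i = i0")
      case True
      then show ?thesis using conformal_add[OF a(2) gi0 gN] by simp
    next
      case False
      then show ?thesis using g(2)[rule_format, of i] that by simp
    qed
    ultimately have "(\<forall>i<N. ?h i = 0\<^sub>v ?n) \<or> (\<forall>i<N. ?h i = f i)" using prim by blast
    then show "(\<forall>i<Suc N. g i = 0\<^sub>v ?n) \<or> (\<forall>i<Suc N. g i = ?f i)"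
    proof
      assume h: "\<forall>i<N. ?h i = 0\<^sub>v ?n"
      then have "g i0 + g N = 0\<^sub>v ?n" using i0 by auto
      then have "g i0 = 0\<^sub>v ?n" "g N = 0\<^sub>v ?n"
        using conformal_add_eq(1)[OF a(2) gi0 gN car] by auto
      moreover have "g i = 0\<^sub>v ?n" if "i < N" "i \<noteq> i0" for i using h that by auto
      ultimately have "g i = 0\<^sub>v ?n" if "i < Suc N" for i
        using that by (cases "i = N"; cases "i = i0") auto
      then show ?thesis by blast
    next
      assume h: "\<forall>i<N. ?h i = f i"
      then have "g i0 + g N = f i0" using i0 by auto
      then have "g i0 = a" "g N = f i0 - a"
        using conformal_add_eq(2)[OF a(2) gi0 gN car] by auto
      moreover have "g i = f i" if "i < N" "i \<noteq> i0" for i using h that by auto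
      ultimately have "g i = ?f i" if "i < Suc N" for i
        using that i0 by (cases "i = N"; cases "i = i0") auto
      then show ?thesis by blast
    qed
  qed
qed

text \<open>Splitting off a circuit keeps the total 1-norm and adds one nonzero layer. Nonzero
  integer layers have norm at least 1, so the norm bounds their number and the process
  stops.\<close>

lemma primitive_layers_refine:
  assumes conf: "\<And>z. z \<in> mat_kernel A \<Longrightarrow> z \<noteq> 0\<^sub>v (dim_col A) \<Longrightarrow> \<exists>c. elementary A c \<and> conformal c z"
    and "primitive_layers A N f"
  shows "\<exists>N' f'. primitive_layers A N' f' \<and>
     (\<forall>i<N'. f' i = 0\<^sub>v (dim_col A) \<or> elementary A (f' i)) \<and>
     card {i. i < N \<and> f i \<noteq> 0\<^sub>v (dim_col A)} \<le> card {i. i < N' \<and> f' i \<noteq> 0\<^sub>v (dim_col A)}"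
  using assms(2)
proof (induction "(\<Sum>i<N. norm1 (f i)) - card {i. i < N \<and> f i \<noteq> 0\<^sub>v (dim_col A)}"
    arbitrary: N f rule: less_induct)
  case less
  let ?n = "dim_col A"
  let ?T = "\<lambda>N f. {i. i < N \<and> f i \<noteq> 0\<^sub>v ?n}"
  show ?case
  proof (cases "\<forall>i<N. f i = 0\<^sub>v ?n \<or> elementary A (f i)")
    case True
    then show ?thesis using less.prems by blast
  next
    case False
    then obtain i0 where i0: "i0 < N" "f i0 \<noteq> 0\<^sub>v ?n" "\<not> elementary A (f i0)" by blast
    have fk: "f i \<in> mat_kernel A" if "i < N" for i
      using less.prems that by (simp add: primitive_layers_def layers_kernel_def)
    obtain c where c: "elementary A c" "conformal c (f i0)" using conf fk i0 by blast
    have ck: "c \<in> mat_kernel A" and c0: "c \<noteq> 0\<^sub>v ?n" using c(1) by (auto simp: elementary_def)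
    have "c \<noteq> f i0" using c(1) i0 by blast
    moreover have "c \<in> carrier_vec ?n" "f i0 \<in> carrier_vec ?n"
      using ck fk[OF i0(1)] by (auto simp: mat_kernel_def)
    ultimately have d0: "f i0 - c \<noteq> 0\<^sub>v ?n" using minus_eq_zero_vec_iff by metis
    let ?f = "f(i0 := c, N := f i0 - c)"
    have p: "primitive_layers A (Suc N) ?f" by (rule primitive_layers_split[OF less.prems i0(1) ck c(2)])
    have T: "?T (Suc N) ?f = insert N (?T N f)" using i0 c0 d0 by (auto simp: less_Suc_eq)
    have card: "card (?T (Suc N) ?f) = Suc (card (?T N f))" unfolding T by simp
    have "(\<Sum>i<Suc N. norm1 (?f i)) = (\<Sum>i<N. norm1 (?f i)) + norm1 (f i0 - c)" by simp
    also have "(\<Sum>i<N. norm1 (?f i)) = norm1 c + (\<Sum>i\<in>{..<N} - {i0}. norm1 (f i))"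
      using i0(1) by (subst sum.remove[of _ i0]) (auto intro!: sum.cong)
    also have "\<dots> + norm1 (f i0 - c) = norm1 (f i0) + (\<Sum>i\<in>{..<N} - {i0}. norm1 (f i))"
      using norm1_conformal_add[OF c(2)] by simp
    also have "\<dots> = (\<Sum>i<N. norm1 (f i))" using i0(1) by (subst sum.remove[of "{..<N}" i0]) auto
    finally have norm: "(\<Sum>i<Suc N. norm1 (?f i)) = (\<Sum>i<N. norm1 (f i))" .
    \<comment> \<open>This bound is what makes the truncated difference of naturals in the measure
      strictly decrease.\<close>
    have "card (?T (Suc N) ?f) \<le> (\<Sum>i\<in>?T (Suc N) ?f. norm1 (?f i))"
    proof -
      have "1 \<le> norm1 (?f i)" if "i \<in> ?T (Suc N) ?f" for i
      proof -
        have "?f i \<in> carrier_vec ?n" "?f i \<noteq> 0\<^sub>v ?n"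
          using that p layers_kernel_carrier[of A "Suc N" ?f i] by (auto simp: primitive_layers_def)
        then have "norm1 (?f i) \<noteq> 0" using norm1_eq_0 by blast
        then show ?thesis by simp
      qed
      then show ?thesis using sum_mono[of "?T (Suc N) ?f" "\<lambda>_. 1" "\<lambda>i. norm1 (?f i)"] by simp
    qed
    also have "\<dots> \<le> (\<Sum>i<Suc N. norm1 (?f i))" by (intro sum_mono2) auto
    finally have "card (?T (Suc N) ?f) \<le> (\<Sum>i<N. norm1 (f i))" unfolding norm .
    then have "(\<Sum>i<Suc N. norm1 (?f i)) - card (?T (Suc N) ?f) < (\<Sum>i<N. norm1 (f i)) - card (?T N f)"
      unfolding norm card by simp
    from less.hyps[OF this p] obtain N' f' where f': "primitive_layers A N' f'"
      "\<forall>i<N'. f' i = 0\<^sub>v ?n \<or> elementary A (f' i)" "card (?T (Suc N) ?f) \<le> card (?T N' f')" by blast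
    have "card (?T N f) \<le> card (?T N' f')" using f'(3) unfolding card by (rule Suc_leD)
    then show ?thesis using f'(1,2) by blast
  qed
qed

text \<open>Given a Graver element, refinement yields one of at least the same type, possibly for a
  larger number of blocks, whose nonzero layers are all circuits; such an element is in the
  universal Groebner basis.\<close>

theorem groebner_complexity_eq_graver_complexity:
  assumes conf: "\<And>z. z \<in> mat_kernel A \<Longrightarrow> z \<noteq> 0\<^sub>v (dim_col A) \<Longrightarrow> \<exists>c. elementary A c \<and> conformal c z"
  shows "groebner_complexity TYPE('k::field) A = graver_complexity A"
proof (rule antisym)
  let ?n = "dim_col A"
  have "universal_groebner_basis TYPE('k) (lawrence_lifting A N) \<subseteq> graver_basis (lawrence_lifting A N)" for N
    unfolding graver_basis_eq_primitive using universal_groebner_basis_primitive by blast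
  then show "groebner_complexity TYPE('k) A \<le> graver_complexity A"
    unfolding groebner_complexity_def graver_complexity_def by (intro SUP_mono' SUP_subset_mono) auto
  show "graver_complexity A \<le> groebner_complexity TYPE('k) A"
    unfolding graver_complexity_def
  proof (intro SUP_least)
    fix N x assume "x \<in> graver_basis (lawrence_lifting A N)"
    then have p: "primitive (lawrence_lifting A N) x" by (simp add: graver_basis_eq_primitive)
    then have x: "x \<in> carrier_vec (N * ?n)" by (simp add: primitive_def mat_kernel_def)
    obtain N' f where f: "primitive_layers A N' f"
      "\<forall>i<N'. f i = 0\<^sub>v ?n \<or> elementary A (f i)"
      "card {i. i < N \<and> layer ?n x i \<noteq> 0\<^sub>v ?n} \<le> card {i. i < N' \<and> f i \<noteq> 0\<^sub>v ?n}"
      using primitive_layers_refine[OF conf, of N "layer ?n x"] p primitive_lawrence_iff[OF x] by auto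
    let ?y = "of_layers ?n N' f"
    have ly: "layer ?n ?y i = f i" if "i < N'" for i using primitive_of_layers(2)[OF f(1) that] .
    have "?y \<in> universal_groebner_basis TYPE('k) (lawrence_lifting A N')"
      using f(2) ly by (intro elementary_universal_groebner primitive_of_layers(1) f(1)) auto
    moreover have "N' \<ge> 1" using f(1) by (auto simp: primitive_layers_def)
    ultimately have y: "enat (vec_type ?n N' ?y) \<le> groebner_complexity TYPE('k) A"
      unfolding groebner_complexity_def by (intro SUP_upper2[of N'] SUP_upper2[of ?y]) auto
    have "vec_type ?n N' ?y = card {i. i < N' \<and> f i \<noteq> 0\<^sub>v ?n}"
      unfolding vec_type_def using ly by (intro arg_cong[where f = card]) auto
    then have "enat (vec_type ?n N x) \<le> enat (vec_type ?n N' ?y)"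
      using f(3) by (simp add: vec_type_def)
    then show "enat (vec_type ?n N x) \<le> groebner_complexity TYPE('k) A" using y by (rule order.trans)
  qed
qed

subsection \<open>Cycles of transportation problems\<close>

lemma dim_transportation_mat [simp]:
  "dim_col (transportation_mat p q) = p * q" "dim_row (transportation_mat p q) = p + q"
  by (simp_all add: transportation_mat_def)

lemma transportation_kernel_iff:
  "z \<in> mat_kernel (transportation_mat p q) \<longleftrightarrow> dim_vec z = p * q \<and>
     (\<forall>i<p. (\<Sum>j<q. z $ (i * q + j)) = 0) \<and> (\<forall>j<q. (\<Sum>i<p. z $ (i * q + j)) = 0)"
proof (cases "dim_vec z = p * q")
  case z: True
  let ?T = "transportation_mat p q"
  have row: "(?T *\<^sub>v z) $ k = (\<Sum>c<p * q. ?T $$ (k, c) * z $ c)" if "k < p + q" for k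
    using z that by (simp add: scalar_prod_def atLeast0LessThan)
  have rows: "(?T *\<^sub>v z) $ i = (\<Sum>j<q. z $ (i * q + j))" if i: "i < p" for i
  proof -
    have "(?T *\<^sub>v z) $ i = (\<Sum>c<p * q. (if c div q = i then 1 else 0) * z $ c)"
      using i by (subst row) (auto simp: transportation_mat_def intro!: sum.cong)
    also have "\<dots> = (\<Sum>i'<p. \<Sum>j<q. if i' = i then z $ (i' * q + j) else 0)"
      unfolding sum_layers by (intro sum.cong refl) auto
    also have "\<dots> = (\<Sum>i'<p. if i' = i then \<Sum>j<q. z $ (i' * q + j) else 0)"
      by (intro sum.cong refl) auto
    finally show ?thesis using i by simp
  qed
  have cols: "(?T *\<^sub>v z) $ (p + j) = (\<Sum>i<p. z $ (i * q + j))" if j: "j < q" for j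
  proof -
    have "(?T *\<^sub>v z) $ (p + j) = (\<Sum>c<p * q. (if c mod q = j then 1 else 0) * z $ c)"
      using j by (subst row) (auto simp: transportation_mat_def intro!: sum.cong)
    also have "\<dots> = (\<Sum>i<p. \<Sum>j'<q. if j' = j then z $ (i * q + j') else 0)"
      unfolding sum_layers by (intro sum.cong refl) auto
    finally show ?thesis using j by simp
  qed
  have split: "k < p \<or> (\<exists>j<q. k = p + j)" if "k < p + q" for k
    using that by presburger
  have "?T *\<^sub>v z = 0\<^sub>v (p + q) \<longleftrightarrow> (\<forall>k<p + q. (?T *\<^sub>v z) $ k = 0)"
    by (auto simp del: index_mult_mat_vec intro!: eq_vecI)
  also have "\<dots> \<longleftrightarrow> (\<forall>i<p. (?T *\<^sub>v z) $ i = 0) \<and> (\<forall>j<q. (?T *\<^sub>v z) $ (p + j) = 0)"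
    using split by (metis add_strict_left_mono trans_less_add1)
  finally show ?thesis
    using z rows cols by (auto simp: mat_kernel_def intro: carrier_vecI)
qed (auto simp: mat_kernel_def)

lemma sum_zero_sign_change:
  fixes f :: "nat \<Rightarrow> int"
  assumes "(\<Sum>i<n. f i) = 0" "k < n"
  shows "f k < 0 \<Longrightarrow> \<exists>i<n. f i > 0" "f k > 0 \<Longrightarrow> \<exists>i<n. f i < 0"
proof -
  have *: "\<exists>i<n. g i > 0" if "(\<Sum>i<n. g i) = 0" "g k < 0" for g :: "nat \<Rightarrow> int"
  proof (rule ccontr)
    assume "\<not> (\<exists>i<n. g i > 0)"
    then have "\<forall>i\<in>{..<n}. g i \<le> 0" by (meson lessThan_iff not_less)
    then have "(\<Sum>i<n. g i) < (\<Sum>i<n. 0)"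
      using that(2) assms(2) by (intro sum_strict_mono_ex1) auto
    then show False using that(1) by simp
  qed
  show "f k < 0 \<Longrightarrow> \<exists>i<n. f i > 0" using *[of f] assms(1) by blast
  show "f k > 0 \<Longrightarrow> \<exists>i<n. f i < 0" using *[of "\<lambda>i. - f i"] assms(1) by (simp add: sum_negf)
qed

lemma sum_two_support:
  fixes f :: "nat \<Rightarrow> int"
  assumes "a < n" "b < n" "a \<noteq> b" "\<And>i. i < n \<Longrightarrow> i \<noteq> a \<Longrightarrow> i \<noteq> b \<Longrightarrow> f i = 0"
  shows "(\<Sum>i<n. f i) = f a + f b"
proof -
  have "(\<Sum>i<n. f i) = (\<Sum>i\<in>{a, b}. f i)" using assms by (intro sum.mono_neutral_right) auto
  then show ?thesis using assms(3) by simp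
qed

text \<open>An invariant set of least cardinality is mapped onto itself, since its image is
  invariant too, and a surjection of a finite set is injective. Such a set is a single cycle of
  \<open>f\<close>.\<close>

lemma minimal_invariant_subset:
  assumes P: "finite P" "P \<noteq> {}" "f ` P \<subseteq> P"
  obtains R where "R \<subseteq> P" "R \<noteq> {}" "f ` R = R" "inj_on f R"
    "\<And>R'. R' \<subseteq> R \<Longrightarrow> R' \<noteq> {} \<Longrightarrow> f ` R' \<subseteq> R' \<Longrightarrow> R' = R"
proof -
  let ?Q = "\<lambda>R. R \<subseteq> P \<and> R \<noteq> {} \<and> f ` R \<subseteq> R"
  obtain R where R: "?Q R" and least: "\<And>R'. ?Q R' \<Longrightarrow> card R \<le> card R'"
    using ex_has_least_nat[of ?Q P card] P by blast
  have fin: "finite R" using R P(1) finite_subset by blast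
  have min: "R' = R" if "R' \<subseteq> R" "R' \<noteq> {}" "f ` R' \<subseteq> R'" for R'
    using card_seteq[OF fin that(1)] least[of R'] that R by blast
  have surj: "f ` R = R" using R by (intro min) auto
  then have "inj_on f R" using fin by (intro eq_card_imp_inj_on) simp_all
  then show thesis using that R surj min by blast
qed

text \<open>
  From a positive entry one moves along its column to a negative entry, and from there along its
  row to a positive entry. A minimal set of rows invariant under this walk is a cycle of the
  bipartite graph of the table.
\<close>

lemma transportation_conformal_elementary:
  assumes z: "z \<in> mat_kernel (transportation_mat p q)" and z0: "z \<noteq> 0\<^sub>v (p * q)"
  shows "\<exists>C. elementary (transportation_mat p q) C \<and> conformal C z"
proof -
  define e where "e i j = z $ (i * q + j)" for i j
  have dz: "dim_vec z = p * q" and rows: "\<And>i. i < p \<Longrightarrow> (\<Sum>j<q. e i j) = 0"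
    and cols: "\<And>j. j < q \<Longrightarrow> (\<Sum>i<p. e i j) = 0"
    using z unfolding transportation_kernel_iff e_def by auto
  define P where "P = {i. i < p \<and> (\<exists>j<q. e i j > 0)}"
  have "\<exists>k<p * q. z $ k \<noteq> 0" using z0 dz by (auto simp: vec_eq_iff)
  then obtain k where k: "k < p * q" "z $ k \<noteq> 0" by blast
  obtain i0 j0 where ij0: "i0 < p" "j0 < q" "k = i0 * q + j0" using layer_position_cases[OF k(1)] .
  then have "e i0 j0 \<noteq> 0" using k by (simp add: e_def)
  then have "\<exists>j<q. e i0 j > 0"
    using sum_zero_sign_change(1)[OF rows[OF ij0(1)] ij0(2)] ij0(2) by (cases "e i0 j0 > 0") auto
  then have "P \<noteq> {}" using ij0 by (auto simp: P_def)
  have "\<forall>i\<in>P. \<exists>j. j < q \<and> e i j > 0" by (auto simp: P_def)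
  then obtain c where c: "\<And>i. i \<in> P \<Longrightarrow> c i < q \<and> e i (c i) > 0" by metis
  have "\<forall>i\<in>P. \<exists>i'. i' < p \<and> e i' (c i) < 0"
  proof
    fix i assume "i \<in> P"
    then show "\<exists>i'. i' < p \<and> e i' (c i) < 0"
      using sum_zero_sign_change(2)[OF cols[of "c i"], of i] c by (auto simp: P_def)
  qed
  \<comment> \<open>The choice depends on \<open>i\<close> only through the column
    \<open>c i\<close>. Injectivity of \<open>f\<close> therefore passes to \<open>c\<close>, so the
    cycle visits each column at most once.\<close>
  moreover define f where "f i = (SOME i'. i' < p \<and> e i' (c i) < 0)" for i
  ultimately have f: "f i < p \<and> e (f i) (c i) < 0" if "i \<in> P" for i
    using that someI_ex[of "\<lambda>i'. i' < p \<and> e i' (c i) < 0"] by auto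
  have f_c: "f i = f i'" if "c i = c i'" for i i' using that by (simp add: f_def)
  have "f ` P \<subseteq> P"
  proof clarify
    fix i assume i: "i \<in> P"
    then show "f i \<in> P"
      using sum_zero_sign_change(1)[OF rows[of "f i"], of "c i"] f c by (auto simp: P_def)
  qed
  moreover have "finite P" by (simp add: P_def)
  ultimately obtain R where R: "R \<subseteq> P" "R \<noteq> {}" "f ` R = R" and inj: "inj_on f R" and
    min: "\<And>R'. R' \<subseteq> R \<Longrightarrow> R' \<noteq> {} \<Longrightarrow> f ` R' \<subseteq> R' \<Longrightarrow> R' = R"
    using minimal_invariant_subset[of P f] \<open>P \<noteq> {}\<close> by metis
  have cR: "c i < q" "e i (c i) > 0" "i < p" "f i < p" "e (f i) (c i) < 0" "f i \<in> R" if "i \<in> R" for i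
  proof -
    have iP: "i \<in> P" using R(1) that by blast
    show "c i < q" "e i (c i) > 0" "f i < p" "e (f i) (c i) < 0" using c[OF iP] f[OF iP] by auto
    show "i < p" using iP by (simp add: P_def)
    show "f i \<in> R" using R(3) that by blast
  qed
  have inj_c: "i = i'" if "i \<in> R" "i' \<in> R" "c i = c i'" for i i'
    using inj_onD[OF inj f_c[OF that(3)]] that by blast
  \<comment> \<open>The cycle gets 1 where the walk leaves a row and -1 where it enters the next row
    along the same column. The signs of \<open>z\<close> at these places differ, so the two kinds
    never overlap.\<close>
  define pos where "pos i j \<longleftrightarrow> i \<in> R \<and> c i = j" for i j
  define neg where "neg i j \<longleftrightarrow> (\<exists>i'\<in>R. f i' = i \<and> c i' = j)" for i j
  define C where "C = vec (p * q) (\<lambda>k. (if pos (k div q) (k mod q) then 1 else 0)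
      - (if neg (k div q) (k mod q) then 1 else 0 :: int))"
  have e_sign: "pos i j \<Longrightarrow> e i j > 0" "neg i j \<Longrightarrow> e i j < 0" for i j
    using cR by (auto simp: pos_def neg_def)
  have disj: "\<not> (pos i j \<and> neg i j)" for i j using e_sign[of i j] by auto
  have C: "C $ (i * q + j) = (if pos i j then 1 else 0) - (if neg i j then 1 else 0)"
    if "i < p" "j < q" for i j
    using that layer_position_less[OF that] by (simp add: C_def)
  have row_pos: "pos i j \<longleftrightarrow> j = c i" and row_neg: "neg (f i) j \<longleftrightarrow> j = c i" if "i \<in> R" for i j
    using that inj by (auto simp: pos_def neg_def dest: inj_onD)
  have row_none: "\<not> pos i j" "\<not> neg i j" if "i \<notin> R" for i j
    using that R(3) by (auto simp: pos_def neg_def)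
  have col_pos: "pos i' (c i) \<longleftrightarrow> i' = i" and col_neg: "neg i' (c i) \<longleftrightarrow> i' = f i" if "i \<in> R" for i i'
    using that inj_c by (auto simp: pos_def neg_def dest: f_c)
  have col_none: "\<not> pos i j" "\<not> neg i j" if "j \<notin> c ` R" for i j
    using that by (auto simp: pos_def neg_def)
  have Ck: "C \<in> mat_kernel (transportation_mat p q)"
    unfolding transportation_kernel_iff
  proof (intro conjI allI impI)
    fix i assume i: "i < p"
    have "(\<Sum>j<q. C $ (i * q + j)) =
        (\<Sum>j<q. if pos i j then 1 else 0) - (\<Sum>j<q. if neg i j then 1 else 0)"
      using C[OF i] by (simp add: sum_subtractf)
    also have "\<dots> = 0"
    proof (cases "i \<in> R")
      case True
      then obtain i' where i': "i' \<in> R" "i = f i'" using R(3) by blast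
      show ?thesis using row_pos[OF True] row_neg[OF i'(1)] cR(1)[OF True] cR(1)[OF i'(1)] i'(2)
        by simp
    qed (simp add: row_none)
    finally show "(\<Sum>j<q. C $ (i * q + j)) = 0" .
  next
    fix j assume j: "j < q"
    have "(\<Sum>i<p. C $ (i * q + j)) =
        (\<Sum>i<p. if pos i j then 1 else 0) - (\<Sum>i<p. if neg i j then 1 else 0)"
      using C[OF _ j] by (simp add: sum_subtractf)
    also have "\<dots> = 0"
    proof (cases "j \<in> c ` R")
      case True
      then obtain i where i: "i \<in> R" "j = c i" by blast
      show ?thesis using col_pos[OF i(1)] col_neg[OF i(1)] cR(3,4)[OF i(1)] i(2) by simp
    qed (simp add: col_none)
    finally show "(\<Sum>i<p. C $ (i * q + j)) = 0" .
  qed (simp add: C_def)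
  have "conformal C z" unfolding conformal_def
  proof (intro conjI allI impI)
    fix k assume "k < dim_vec z"
    then have "k < p * q" using dz by simp
    then obtain i j where ij: "i < p" "j < q" "k = i * q + j" by (rule layer_position_cases)
    then show "0 \<le> C $ k \<and> C $ k \<le> z $ k \<or> z $ k \<le> C $ k \<and> C $ k \<le> 0"
      using C[OF ij(1,2)] e_sign[of i j] disj[of i j] by (auto simp: e_def)
  qed (simp add: C_def dz)
  moreover have "elementary (transportation_mat p q) C"
    unfolding elementary_def dim_transportation_mat
  proof (intro conjI ballI impI)
    show "C \<in> mat_kernel (transportation_mat p q)" by (rule Ck)
    obtain i where i: "i \<in> R" using R(2) by blast
    have "C $ (i * q + c i) = 1"
      using C[of i "c i"] cR[OF i] row_pos[OF i, of "c i"] disj[of i "c i"] by simp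
    then show "\<exists>k<p * q. C $ k > 0"
      using layer_position_less[of i p "c i" q] cR[OF i] by (intro exI[of _ "i * q + c i"]) simp
    have "C $ (f i * q + c i) = - 1"
      using C[of "f i" "c i"] cR[OF i] row_neg[OF i, of "c i"] disj[of "f i" "c i"] by simp
    then show "\<exists>k<p * q. C $ k < 0"
      using layer_position_less[of "f i" p "c i" q] cR[OF i] by (intro exI[of _ "f i * q + c i"]) simp
    fix d assume dk: "d \<in> mat_kernel (transportation_mat p q)"
      and supp: "\<forall>k<p * q. C $ k = 0 \<longrightarrow> d $ k = 0"
    define \<delta> where "\<delta> i j = d $ (i * q + j)" for i j
    have drow: "(\<Sum>j<q. \<delta> i j) = 0" if "i < p" for i
      using dk that unfolding transportation_kernel_iff \<delta>_def by blast
    have dcol: "(\<Sum>i<p. \<delta> i j) = 0" if "j < q" for j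
      using dk that unfolding transportation_kernel_iff \<delta>_def by blast
    have d0: "\<delta> i j = 0" if "i < p" "j < q" "\<not> pos i j" "\<not> neg i j" for i j
      using supp C[OF that(1,2)] that layer_position_less[OF that(1,2)] by (simp add: \<delta>_def)
    \<comment> \<open>The column \<open>c i\<close> meets the cycle in the rows \<open>i\<close> and
      \<open>f i\<close> only.\<close>
    have opp: "\<delta> (f i) (c i) = - \<delta> i (c i)" if i: "i \<in> R" for i
    proof -
      have "i \<noteq> f i" using cR[OF i] by auto
      then have "(\<Sum>i'<p. \<delta> i' (c i)) = \<delta> i (c i) + \<delta> (f i) (c i)"
        using cR[OF i] col_pos[OF i] col_neg[OF i] by (intro sum_two_support d0) auto
      then show ?thesis using dcol cR[OF i] by simp
    qed
    have step: "\<delta> (f i) (c (f i)) = \<delta> i (c i)" if i: "i \<in> R" for i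
    proof -
      have fi: "f i \<in> R" using cR(6)[OF i] .
      have "c i \<noteq> c (f i)" using cR(2)[OF fi] cR(5)[OF i] by auto
      then have "(\<Sum>j<q. \<delta> (f i) j) = \<delta> (f i) (c i) + \<delta> (f i) (c (f i))"
        using cR[OF i] cR[OF fi] row_neg[OF i] row_pos[OF fi] by (intro sum_two_support d0) auto
      then show ?thesis using drow cR[OF i] opp[OF i] by simp
    qed
    \<comment> \<open>The rows of the cycle carrying one common value are invariant under
      \<open>f\<close> by \<open>step\<close>; minimality of \<open>R\<close> makes them all of
      \<open>R\<close>.\<close>
    have "{i' \<in> R. \<delta> i' (c i') = \<delta> i (c i)} = R"
      using i cR(6) step by (intro min) auto
    then have const: "\<delta> i' (c i') = \<delta> i (c i)" if "i' \<in> R" for i' using that by blast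
    show "\<exists>m. \<forall>k<p * q. d $ k = m * C $ k"
    proof (intro exI allI impI)
      fix k assume "k < p * q"
      then obtain a b where ab: "a < p" "b < q" "k = a * q + b" by (rule layer_position_cases)
      have "\<delta> a b = \<delta> i (c i) * C $ (a * q + b)"
      proof -
        consider "pos a b" | "neg a b" | "\<not> pos a b" "\<not> neg a b" by blast
        then show ?thesis
        proof cases
          case 1
          then show ?thesis using C[OF ab(1,2)] disj[of a b] const by (auto simp: pos_def)
        next
          case 2
          then obtain i' where "i' \<in> R" "f i' = a" "c i' = b" by (auto simp: neg_def)
          then have "\<delta> a b = - \<delta> i (c i)" using opp[of i'] const[of i'] by auto
          then show ?thesis using 2 C[OF ab(1,2)] disj[of a b] by simp
        next
          case 3
          then show ?thesis using C[OF ab(1,2)] d0[OF ab(1,2)] by simp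
        qed
      qed
      then show "d $ k = \<delta> i (c i) * C $ k" by (simp add: \<delta>_def ab(3))
    qed
  qed
  ultimately show ?thesis by blast
qed

subsection \<open>A Graver basis element of type 27\<close>

lemma transportation_3_4_kernel_iff:
  "z \<in> mat_kernel (transportation_mat 3 4) \<longleftrightarrow> dim_vec z = 12 \<and>
     z $ 0 + z $ 1 + z $ 2 + z $ 3 = 0 \<and> z $ 4 + z $ 5 + z $ 6 + z $ 7 = 0 \<and>
     z $ 8 + z $ 9 + z $ 10 + z $ 11 = 0 \<and> z $ 0 + z $ 4 + z $ 8 = 0 \<and>
     z $ 1 + z $ 5 + z $ 9 = 0 \<and> z $ 2 + z $ 6 + z $ 10 = 0 \<and> z $ 3 + z $ 7 + z $ 11 = 0"
proof -
  have sum: "(\<Sum>i<3. h i) = h 0 + h 1 + h 2" "(\<Sum>i<4. h i) = h 0 + h 1 + h 2 + h 3" for h :: "nat \<Rightarrow> int"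
    by (simp_all add: eval_nat_numeral)
  have all: "(\<forall>i<3. h i) \<longleftrightarrow> h 0 \<and> h 1 \<and> h 2" "(\<forall>i<4. h i) \<longleftrightarrow> h 0 \<and> h 1 \<and> h 2 \<and> h 3" for h :: "nat \<Rightarrow> bool"
    by (simp_all add: eval_nat_numeral All_less_Suc conj_ac)
  show ?thesis unfolding transportation_kernel_iff sum all by (simp add: numeral_2_eq_2)
qed

lemma all_less_12: "(\<forall>i<12. h i) \<longleftrightarrow> h 0 \<and> h 1 \<and> h 2 \<and> h 3 \<and> h 4 \<and> h 5 \<and> h 6 \<and> h 7 \<and> h 8 \<and> h 9 \<and>
    h 10 \<and> h (11::nat)"
  by (simp add: eval_nat_numeral All_less_Suc conj_ac)

text \<open>Each cycle is a hexagon: a 1 and a -1 in each of the three rows and in each of three of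
  the four columns. Wide gaps in the lists separate table rows.\<close>

definition "cycle1 = vec 12 ((!) [1, 0, 0, -1,  0, -1, 0, 1,  -1, 1, 0, 0 :: int])"
definition "cycle2 = vec 12 ((!) [-1, 1, 0, 0,  0, -1, 1, 0,  1, 0, -1, 0 :: int])"
definition "cycle3 = vec 12 ((!) [0, 0, -1, 1,  1, 0, 0, -1,  -1, 0, 1, 0 :: int])"
definition "cycle4 = vec 12 ((!) [1, 0, 0, -1,  -1, 1, 0, 0,  0, -1, 0, 1 :: int])"
definition "cycle5 = vec 12 ((!) [-1, 1, 0, 0,  1, 0, -1, 0,  0, -1, 1, 0 :: int])"
definition "cycle6 = vec 12 ((!) [0, -1, 1, 0,  0, 1, 0, -1,  0, 0, -1, 1 :: int])"
definition "cycle7 = vec 12 ((!) [0, -1, 0, 1,  -1, 1, 0, 0,  1, 0, 0, -1 :: int])"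

lemmas cycle_defs = cycle1_def cycle2_def cycle3_def cycle4_def cycle5_def cycle6_def cycle7_def
lemmas cycle_simps = cycle_defs transportation_3_4_kernel_iff all_less_12

text \<open>The multiplier is read off at position \<open>a\<close>, where the cycle has entry 1;
  \<open>b\<close> only witnesses a negative entry.\<close>

lemma elementary_3_4I:
  assumes "z \<in> mat_kernel (transportation_mat 3 4)" "a < 12" "z $ a = 1" "b < 12" "z $ b = - 1"
    and "\<And>d. d \<in> mat_kernel (transportation_mat 3 4) \<Longrightarrow> \<forall>i<12. z $ i = 0 \<longrightarrow> d $ i = 0 \<Longrightarrow>
      \<forall>i<12. d $ i = d $ a * z $ i"
  shows "elementary (transportation_mat 3 4) z"
proof -
  have "z $ a > 0" "z $ b < 0" using assms(3,5) by simp_all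
  moreover have "dim_col (transportation_mat 3 4) = 12" by simp
  ultimately show ?thesis unfolding elementary_def using assms by metis
qed

lemma cycles_elementary:
  "elementary (transportation_mat 3 4) cycle1" "elementary (transportation_mat 3 4) cycle2"
  "elementary (transportation_mat 3 4) cycle3" "elementary (transportation_mat 3 4) cycle4"
  "elementary (transportation_mat 3 4) cycle5" "elementary (transportation_mat 3 4) cycle6"
  "elementary (transportation_mat 3 4) cycle7"
        apply (rule elementary_3_4I[where a = 0 and b = 3]; simp add: cycle_simps)
       apply (rule elementary_3_4I[where a = 1 and b = 0]; simp add: cycle_simps)
      apply (rule elementary_3_4I[where a = 3 and b = 2]; simp add: cycle_simps)
     apply (rule elementary_3_4I[where a = 0 and b = 3]; simp add: cycle_simps)
    apply (rule elementary_3_4I[where a = 1 and b = 0]; simp add: cycle_simps)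
   apply (rule elementary_3_4I[where a = 2 and b = 1]; simp add: cycle_simps)
  apply (rule elementary_3_4I[where a = 3 and b = 1]; simp add: cycle_simps)
  done

text \<open>
  The seven cycles span a space of dimension six; their unique primitive integer relation has
  the coefficients 6, 4, 3, 2, 4, 3, 5, which sum to 27.
\<close>

definition cycle_layers :: "int vec list" where
  "cycle_layers = replicate 6 cycle1 @ replicate 4 cycle2 @ replicate 3 cycle3 @ replicate 2 cycle4 @
     replicate 4 cycle5 @ replicate 3 cycle6 @ replicate 5 cycle7"

lemma length_cycle_layers: "length cycle_layers = 27"
  by (simp add: cycle_layers_def)

text \<open>The brackets follow the runs of equal cycles, of lengths 6, 4, 3, 2, 4, 3, 5.\<close>

lemma sum_less_27: "(\<Sum>i<27. h i) = h 0 + h 1 + h 2 + h 3 + h 4 + h 5 + (h 6 + h 7 + h 8 + h 9)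
    + (h 10 + h 11 + h 12) + (h 13 + h 14) + (h 15 + h 16 + h 17 + h 18) + (h 19 + h 20 + h 21)
    + (h 22 + h 23 + h 24 + h 25 + h (26::nat))" for h :: "nat \<Rightarrow> int"
  by (simp add: eval_nat_numeral)

lemma cycle_layers_elementary:
  assumes "i < 27"
  shows "elementary (transportation_mat 3 4) (cycle_layers ! i)"
proof -
  have "cycle_layers ! i \<in> set cycle_layers" using assms length_cycle_layers by (intro nth_mem) simp
  then show ?thesis using cycles_elementary by (auto simp: cycle_layers_def)
qed

lemma sum_cycle_layers:
  fixes t :: "nat \<Rightarrow> int"
  shows "(\<Sum>i<27. t i * cycle_layers ! i $ j) =
    (t 0 + t 1 + t 2 + t 3 + t 4 + t 5) * cycle1 $ j + (t 6 + t 7 + t 8 + t 9) * cycle2 $ j +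
    (t 10 + t 11 + t 12) * cycle3 $ j + (t 13 + t 14) * cycle4 $ j +
    (t 15 + t 16 + t 17 + t 18) * cycle5 $ j + (t 19 + t 20 + t 21) * cycle6 $ j +
    (t 22 + t 23 + t 24 + t 25 + t 26) * cycle7 $ j"
  unfolding sum_less_27 by (simp add: cycle_layers_def nth_append distrib_right)

text \<open>The relation is solved in terms of \<open>T4\<close>, the smallest of the seven
  coefficients, where few values remain. Its total is 27/2 times \<open>T4\<close>.\<close>

lemma cycle_relation:
  fixes T1 T2 T3 T4 T5 T6 T7 :: int
  assumes "\<forall>j<12. T1 * cycle1 $ j + T2 * cycle2 $ j + T3 * cycle3 $ j + T4 * cycle4 $ j +
    T5 * cycle5 $ j + T6 * cycle6 $ j + T7 * cycle7 $ j = 0"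
    and "0 \<le> T4" "T4 \<le> 2"
  shows "T1 + T2 + T3 + T4 + T5 + T6 + T7 = 0 \<or> T1 + T2 + T3 + T4 + T5 + T6 + T7 = 27"
proof -
  have rel: "T1 = 3 * T4" "T2 = 2 * T4" "2 * T3 = 3 * T4" "T5 = 2 * T4" "2 * T6 = 3 * T4" "2 * T7 = 5 * T4"
    using assms(1) by (simp_all add: all_less_12 cycle_defs)
  \<comment> \<open>The value 1 would make \<open>2 * T3\<close> equal to 3.\<close>
  then have "T4 \<noteq> 1" by presburger
  then have "T4 = 0 \<or> T4 = 2" using assms(2,3) by linarith
  then show ?thesis using rel by auto
qed

text \<open>Each layer being a circuit, a conformal kernel family keeps or drops whole layers. The
  numbers of kept copies of the seven cycles satisfy their relation, so 0 or 27 layers are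
  kept.\<close>

lemma primitive_cycle_layers:
  "primitive_layers (transportation_mat 3 4) 27 (\<lambda>i. cycle_layers ! i)"
  unfolding primitive_layers_def
proof (intro conjI allI impI)
  let ?A = "transportation_mat 3 4"
  have dim: "cycle_layers ! i \<in> carrier_vec 12" "cycle_layers ! i \<in> mat_kernel ?A"
    "cycle_layers ! i \<noteq> 0\<^sub>v 12" if "i < 27" for i
    using cycle_layers_elementary[OF that] by (auto simp: elementary_def mat_kernel_def)
  show "layers_kernel ?A 27 (\<lambda>i. cycle_layers ! i)"
    unfolding layers_kernel_def
  proof (intro conjI allI impI)
    fix j assume "j < dim_col ?A"
    moreover have "\<forall>j<12. (\<Sum>i<27. 1 * cycle_layers ! i $ j) = 0"
      unfolding sum_cycle_layers by (simp add: all_less_12 cycle_defs)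
    ultimately show "(\<Sum>i<27. cycle_layers ! i $ j) = 0" by simp
  qed (use dim in auto)
  show "\<exists>i<27. cycle_layers ! i \<noteq> 0\<^sub>v (dim_col ?A)" using dim(3)[of 0] by (intro exI[of _ 0]) simp
  fix g assume g: "layers_kernel ?A 27 g" "\<forall>i<27. conformal (g i) (cycle_layers ! i)"
  have dich: "g i = 0\<^sub>v 12 \<or> g i = cycle_layers ! i" if "i < 27" for i
    using elementary_conformal[OF cycle_layers_elementary[OF that], of "g i"] g that
    by (simp add: layers_kernel_def)
  define t :: "nat \<Rightarrow> int" where "t i = (if g i = 0\<^sub>v 12 then 0 else 1)" for i
  have t01: "t i = 0 \<or> t i = 1" for i by (simp add: t_def)
  have gt: "g i $ j = t i * cycle_layers ! i $ j" if "i < 27" "j < 12" for i j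
    using dich[OF that(1)] that by (auto simp: t_def)
  have zero: "\<forall>j<12. (\<Sum>i<27. t i * cycle_layers ! i $ j) = 0"
    using g(1) gt by (simp add: layers_kernel_def)
  \<comment> \<open>Layers 13 and 14 are the two copies of \<open>cycle4\<close>, which gives the
    bounds required for \<open>T4\<close>.\<close>
  have total: "(\<Sum>i<27. t i) = 0 \<or> (\<Sum>i<27. t i) = 27"
    unfolding sum_less_27 using t01[of 13] t01[of 14]
    by (intro cycle_relation[OF zero[unfolded sum_cycle_layers]]) auto
  from total show "(\<forall>i<27. g i = 0\<^sub>v (dim_col ?A)) \<or> (\<forall>i<27. g i = cycle_layers ! i)"
  proof
    assume "(\<Sum>i<27. t i) = 0"
    then have t0: "t i = 0" if "i < 27" for i
      using that t01 by (subst (asm) sum_nonneg_eq_0_iff) (auto simp: t_def)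
    have "g i = 0\<^sub>v 12" if "i < 27" for i using t0[OF that] by (simp add: t_def split: if_splits)
    then show ?thesis by simp
  next
    assume "(\<Sum>i<27. t i) = 27"
    then have "(\<Sum>i<27. 1 - t i) = 0" by (simp add: sum_subtractf)
    then have t1: "1 - t i = 0" if "i < 27" for i
      using that t01 by (subst (asm) sum_nonneg_eq_0_iff) (auto simp: t_def)
    have "g i \<noteq> 0\<^sub>v 12" if "i < 27" for i using t1[OF that] by (simp add: t_def split: if_splits)
    then show ?thesis using dich by blast
  qed
qed

theorem corollary3:
  shows "groebner_complexity TYPE('k::field) (transportation_mat 3 4)
           = graver_complexity (transportation_mat 3 4)
         \<and> graver_complexity (transportation_mat 3 4) \<ge> 27"
proof
  let ?A = "transportation_mat 3 4"
  show "groebner_complexity TYPE('k) ?A = graver_complexity ?A"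
    by (rule groebner_complexity_eq_graver_complexity) (auto intro: transportation_conformal_elementary)
  let ?x = "of_layers (dim_col ?A) 27 (\<lambda>i. cycle_layers ! i)"
  have "?x \<in> graver_basis (lawrence_lifting ?A 27)"
    unfolding graver_basis_eq_primitive using primitive_of_layers(1)[OF primitive_cycle_layers] by simp
  then have "enat (vec_type (dim_col ?A) 27 ?x) \<le> graver_complexity ?A"
    unfolding graver_complexity_def by (intro SUP_upper2[of 27] SUP_upper2[of ?x]) auto
  moreover have "layer (dim_col ?A) ?x i \<noteq> 0\<^sub>v (dim_col ?A)" if "i < 27" for i
    using primitive_of_layers(2)[OF primitive_cycle_layers that] cycle_layers_elementary[OF that]
    by (auto simp: elementary_def)
  then have "{i. i < 27 \<and> layer (dim_col ?A) ?x i \<noteq> 0\<^sub>v (dim_col ?A)} = {..<27}" by auto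
  then have "vec_type (dim_col ?A) 27 ?x = 27" by (simp add: vec_type_def)
  ultimately show "graver_complexity ?A \<ge> 27" by (simp add: numeral_eq_enat)
qed

end
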